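(* For each $n\ge 1$ let $x_1,\dots,x_n$ be the random points in $\frac1n\mathbb Z$ with joint probability mass function proportional to $$\prod_{1\le i<j\le n}\big(\mu_n(x_i)-\mu_n(x_j)\big)^2\prod_{j=1}^n w_n(nx_j),$$ and let $a_{j,n},b_{j,n}$ be the associated recurrence coefficients. Suppose there exist real-valued continuous functions $a,b$ on $[0,1]$, with $a\ge 0$ and $a\not\equiv 0$, such that for every $\xi\in[0,1]$ $$\lim_{j/n\to\xi}a_{j,n}=a(\xi),\qquad \lim_{j/n\to\xi}b_{j,n}=b(\xi).$$ Then for every polynomial $p$, almost surely as $n\to\infty$, $$\frac1nX_n(p\circ\mu_n)\to\frac1\pi\int_0^1\int_{b(\xi)-2a(\xi)}^{b(\xi)+2a(\xi)}\frac{p(x)}{\sqrt{4a(\xi)^2-(x-b(\xi))^2}}\,dx\,d\xi+\int_{a^{-1}(\{0\})}p(b(\xi))\,d\xi ,$$ where the inner integral in the first term is read as $0$ when $a(\xi)=0$.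
   Context: For each $n$, $\nu_n:\mathbb Z\to\mathbb R$ is strictly monotone and $w_n:\mathbb Z\to[0,\infty)$ satisfies $\sum_{y\in\mathbb Z}|\nu_n(y)|^kw_n(y)<\infty$ for all $k\in\mathbb N$ and has at least $n$ points in its support. Put $\mu_n(x)=\nu_n(nx)$ for $x\in\frac1n\mathbb Z$. For a function $f$, the linear statistic is $X_n(f)=\sum_{j=1}^nf(x_j)$. The point processes for different $n$ are regarded as defined on a common probability space. Recurrence coefficients: $p_{k,n}$ is the polynomial of degree $k$ with positive leading coefficient such that $\sum_{y\in\mathbb Z}p_{k,n}(\nu_n(y))p_{l,n}(\nu_n(y))w_n(y)=\delta_{k,l}$, and $r_{k,n}(y)=p_{k,n}(\nu_n(y))$. They satisfy $\nu_n(y)r_{j,n}(y)=a_{j,n}r_{j+1,n}(y)+b_{j,n}r_{j,n}(y)+a_{j-1,n}r_{j-1,n}(y)$ for $j=0,1,2,\dots$, with $a_{j,n}>0$, $b_{j,n}\in\mathbb R$, $a_{-1,n}=0$. If $w_n$ has finite support, the hypotheses on the coefficients include that these are defined for the indices involved. The limit $\lim_{j/n\to\xi}$ means: for every sequence $j=j(n)$ of nonnegative integers with $j(n)/n\to\xi$ as $n\to\infty$. *)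

theory Defs
  imports "HOL-Probability.Probability" "HOL-Computational_Algebra.Polynomial"
begin

definition weight_support :: "(int \<Rightarrow> real) \<Rightarrow> int set" where
  "weight_support w = {y. w y \<noteq> 0}"

definition admissible :: "nat \<Rightarrow> (int \<Rightarrow> real) \<Rightarrow> (int \<Rightarrow> real) \<Rightarrow> bool" where
  "admissible n \<nu> w \<longleftrightarrow>
     (strict_mono \<nu> \<or> strict_antimono_on UNIV \<nu>) \<and>
     (\<forall>y. 0 \<le> w y) \<and>
     (\<forall>k::nat. (\<lambda>y. \<bar>\<nu> y\<bar> ^ k * w y) summable_on UNIV) \<and>
     (infinite (weight_support w) \<or> n \<le> card (weight_support w))"

text \<open>A weight supported on \<open>N\<close> points has orthonormal polynomials only of degrees \<open>0, \<dots>, N - 1\<close>.\<close>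

definition orth_index :: "(int \<Rightarrow> real) \<Rightarrow> nat \<Rightarrow> bool" where
  "orth_index w k \<longleftrightarrow> infinite (weight_support w) \<or> k < card (weight_support w)"

text \<open>Values of \<open>P\<close> outside \<open>orth_index w\<close> are irrelevant.\<close>

definition orthonormal_polys :: "(int \<Rightarrow> real) \<Rightarrow> (int \<Rightarrow> real) \<Rightarrow> (nat \<Rightarrow> real poly) \<Rightarrow> bool" where
  "orthonormal_polys \<nu> w P \<longleftrightarrow>
     (\<forall>k. orth_index w k \<longrightarrow> degree (P k) = k \<and> 0 < lead_coeff (P k)) \<and>
     (\<forall>k l. orth_index w k \<longrightarrow> orth_index w l \<longrightarrow>
        ((\<lambda>y. poly (P k) (\<nu> y) * poly (P l) (\<nu> y) * w y) has_sum (if k = l then 1 else 0)) UNIV)"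

text \<open>The coefficients with index \<open>j\<close> come from the recurrence at \<open>j\<close>, which involves the
  polynomial of degree \<open>j + 1\<close>; they are therefore defined only if that polynomial is. In that
  case \<open>\<alpha> j\<close> and \<open>\<beta> j\<close> are determined uniquely; the other values are irrelevant.\<close>

definition recurrence_index :: "(int \<Rightarrow> real) \<Rightarrow> nat \<Rightarrow> bool" where
  "recurrence_index w j \<longleftrightarrow> orth_index w (Suc j)"

definition recurrence_coeffs ::
  "(int \<Rightarrow> real) \<Rightarrow> (int \<Rightarrow> real) \<Rightarrow> (nat \<Rightarrow> real poly) \<Rightarrow> (nat \<Rightarrow> real) \<Rightarrow> (nat \<Rightarrow> real) \<Rightarrow> bool" where
  "recurrence_coeffs \<nu> w P \<alpha> \<beta> \<longleftrightarrow>
     (\<forall>j. recurrence_index w j \<longrightarrow>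
        0 < \<alpha> j \<and>
        (\<forall>y. \<nu> y * poly (P j) (\<nu> y) =
           \<alpha> j * poly (P (Suc j)) (\<nu> y) + \<beta> j * poly (P j) (\<nu> y) +
           (if j = 0 then 0 else \<alpha> (j - 1) * poly (P (j - 1)) (\<nu> y))))"

definition lattice :: "nat \<Rightarrow> real set" where
  "lattice n = range (\<lambda>k::int. of_int k / real n)"

text \<open>For \<open>x \<in> lattice n\<close> with \<open>n \<ge> 1\<close> the number \<open>n x\<close> is an integer; the floor only
  retrieves it as an element of the type \<open>int\<close>.\<close>

definition lattice_int :: "nat \<Rightarrow> real \<Rightarrow> int" where
  "lattice_int n x = \<lfloor>real n * x\<rfloor>"

definition \<mu>_of :: "(int \<Rightarrow> real) \<Rightarrow> nat \<Rightarrow> real \<Rightarrow> real" where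
  "\<mu>_of \<nu> n x = \<nu> (lattice_int n x)"

definition ensemble_weight ::
  "(int \<Rightarrow> real) \<Rightarrow> (int \<Rightarrow> real) \<Rightarrow> nat \<Rightarrow> (nat \<Rightarrow> real) \<Rightarrow> real" where
  "ensemble_weight \<nu> w n y =
     (\<Prod>(i, j) \<in> {(i, j). 1 \<le> i \<and> i < j \<and> j \<le> n}. (\<mu>_of \<nu> n (y i) - \<mu>_of \<nu> n (y j))\<^sup>2) *
     (\<Prod>j = 1..n. w (lattice_int n (y j)))"

text \<open>The points are lattice valued, so their joint probability mass function sums to one, which
  determines the proportionality constant \<open>c\<close>.\<close>

definition orthogonal_polynomial_ensemble ::
  "'\<omega> measure \<Rightarrow> (int \<Rightarrow> real) \<Rightarrow> (int \<Rightarrow> real) \<Rightarrow> nat \<Rightarrow> (nat \<Rightarrow> '\<omega> \<Rightarrow> real) \<Rightarrow> bool" where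
  "orthogonal_polynomial_ensemble M \<nu> w n x \<longleftrightarrow>
     (\<forall>j \<in> {1..n}. x j \<in> borel_measurable M \<and> (\<forall>\<omega> \<in> space M. x j \<omega> \<in> lattice n)) \<and>
     (\<exists>c. \<forall>y. (\<forall>j \<in> {1..n}. y j \<in> lattice n) \<longrightarrow>
        measure M {\<omega> \<in> space M. \<forall>j \<in> {1..n}. x j \<omega> = y j} = c * ensemble_weight \<nu> w n y)"

definition linear_statistic :: "nat \<Rightarrow> (nat \<Rightarrow> '\<omega> \<Rightarrow> real) \<Rightarrow> (real \<Rightarrow> real) \<Rightarrow> '\<omega> \<Rightarrow> real" where
  "linear_statistic n x f \<omega> = (\<Sum>j = 1..n. f (x j \<omega>))"

end

theory Submission
  imports Defs "Jordan_Normal_Form.Determinant" "HOL-Real_Asymp.Real_Asymp"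
begin

text \<open>The squared Vandermonde product is a multiple of the squared determinant of the orthonormal
  polynomials. Expanding both determinants over permutations, orthonormality kills all but the
  permutations that agree off the one or two marked points, so that with \<open>F\<close> the matrix of
  multiplication by \<open>p\<close> in the orthonormal basis, the linear statistic has mean
  \<open>\<Sum>k<n. F k k\<close> and variance \<open>\<Sum>k<n. \<Sum>l\<ge>n. (F k l)\<^sup>2\<close>. Since \<open>F\<close> is a polynomial in the
  tridiagonal Jacobi matrix, it is banded, and only boundedly many terms of the variance are
  nonzero. The second moments of the fluctuations divided by \<open>n\<close> are therefore summable, which
  gives almost sure convergence to the limit of the means. Near the index \<open>n \<xi>\<close> the Jacobi matrix
  looks like the Toeplitz matrix with symbol \<open>b \<xi> + 2 * a \<xi> * cos \<theta>\<close>, which identifies the limit of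
  \<open>F k k\<close> as an average over the arcsine law; dominated convergence does the rest.\<close>

subsection \<open>Moments of the determinantal ensemble\<close>

text \<open>The hypotheses control the coefficients only along single sequences with
  \<open>j n / n\<close> convergent, whereas the variance estimate and dominated convergence need a
  bound uniform over all \<open>j \<le> n + degree p\<close>. Compactness of the range of ratios
  supplies it. Multiplication by \<open>p\<close> carries the first \<open>n\<close> orthonormal
  polynomials up to degree \<open>n - 1 + degree p\<close>, past the number of points. Since
  \<open>degree p\<close> is fixed, these indices are governed by the hypotheses at \<xi> = 1, which
  for finitely supported weights also guarantee that the polynomials exist for large
  \<open>n\<close>. This is why the expansion lemmas assume only finitely many recurrence relations.
  The left end behaves differently: along \<xi> = 0 the index may stay bounded, and then the
  boundary of the Jacobi matrix remains visible. The diagonal limit is therefore taken only for 0 <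
  \<xi> < 1, which suffices for an integral. The coupling of the ensembles for different
  \<open>n\<close> is arbitrary: summability of second moments needs no independence.\<close>

lemma det_poly_eval:
  fixes q :: "nat \<Rightarrow> real poly"
  assumes "\<And>i. i < n \<Longrightarrow> degree (q i) = i"
  shows "det (mat n n (\<lambda>(i, j). poly (q i) (t j))) =
    (\<Prod>i<n. lead_coeff (q i)) * (\<Prod>j<n. \<Prod>i<j. t j - t i)"
  using assms
proof (induction n)
  case 0
  show ?case by (simp add: det_dim_zero)
next
  case (Suc n)
  define A where "A s = mat (Suc n) (Suc n) (\<lambda>(i, j). poly (q i) (s j))" for s
  have A: "A s \<in> carrier_mat (Suc n) (Suc n)" for s
    by (simp add: A_def)
  \<comment> \<open>The argument counts roots and needs the first \<open>n\<close> nodes distinct;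
    if two of them coincide, both sides vanish.\<close>
  show ?case
  proof (cases "inj_on t {..<n}")
    case False
    then obtain i j where ij: "i < j" "j < n" "t i = t j"
    proof -
      obtain i j where *: "i < n" "j < n" "t i = t j" "i \<noteq> j"
        using False by (auto simp: inj_on_def)
      then show thesis using that[of i j] that[of j i] by (cases "i < j") auto
    qed
    have "col (A t) i = col (A t) j"
      using ij by (auto simp: A_def col_def)
    then have "det (A t) = 0"
      using det_identical_columns[OF A, of i j t] ij by simp
    moreover have "(\<Prod>j<Suc n. \<Prod>i<j. t j - t i) = 0"
    proof (rule prod_zero)
      have "(\<Prod>i<j. t j - t i) = 0"
        using ij by (intro prod_zero bexI[of _ i]) auto
      then show "\<exists>j\<in>{..<Suc n}. (\<Prod>i<j. t j - t i) = 0"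
        using ij by (intro bexI[of _ j]) auto
    qed simp
    ultimately show ?thesis by (simp add: A_def)
  next
    case True
    \<comment> \<open>Cofactors of the last column do not see the last node. Letting that node vary
      thus makes the determinant a polynomial in it with fixed coefficients \<open>c i\<close> in
      the basis \<open>q i\<close>.\<close>
    define c where "c i = cofactor (A t) i n" for i
    have del: "mat_delete (A s) i n = mat_delete (A t) i n" if "\<And>j. j < n \<Longrightarrow> s j = t j" for s i
    proof (rule eq_matI)
      fix i' j' assume "i' < dim_row (mat_delete (A t) i n)" "j' < dim_col (mat_delete (A t) i n)"
      then have "i' < n" "j' < n" by (simp_all add: A_def)
      then show "mat_delete (A s) i n $$ (i', j') = mat_delete (A t) i n $$ (i', j')"
        by (simp add: mat_delete_def A_def that)
    qed (simp_all add: A_def)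
    have expand: "det (A (t(n := x))) = poly (\<Sum>i<Suc n. Polynomial.smult (c i) (q i)) x" for x
    proof -
      have "det (A (t(n := x))) = (\<Sum>i<Suc n. A (t(n := x)) $$ (i, n) * cofactor (A (t(n := x))) i n)"
        by (rule laplace_expansion_column[OF A]) simp
      also have "\<dots> = (\<Sum>i<Suc n. poly (q i) x * c i)"
      proof (rule sum.cong)
        fix i assume "i \<in> {..<Suc n}"
        moreover have "cofactor (A (t(n := x))) i n = c i"
          using del[of "t(n := x)" i] by (simp add: c_def cofactor_def)
        ultimately show "A (t(n := x)) $$ (i, n) * cofactor (A (t(n := x))) i n = poly (q i) x * c i"
          by (simp add: A_def)
      qed simp
      finally show ?thesis by (simp add: poly_sum mult.commute)
    qed
    have "mat_delete (A t) n n = mat n n (\<lambda>(i, j). poly (q i) (t j))"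
      by (intro eq_matI) (auto simp: mat_delete_def A_def)
    then have cn: "c n = (\<Prod>i<n. lead_coeff (q i)) * (\<Prod>j<n. \<Prod>i<j. t j - t i)"
      using Suc by (simp add: c_def cofactor_def)
    define R where "R = (\<Sum>i<Suc n. Polynomial.smult (c i) (q i))"
    define S where "S = Polynomial.smult (c n * lead_coeff (q n)) (\<Prod>i<n. [:- t i, 1:])"
    have monic: "degree (\<Prod>i<n. [:- t i, 1:]) = n" "Polynomial.coeff (\<Prod>i<n. [:- t i, 1:]) n = 1"
    proof -
      show "degree (\<Prod>i<n. [:- t i, 1:]) = n" by (subst degree_prod_eq_sum_degree) auto
      moreover have "lead_coeff (\<Prod>i<n. [:- t i, 1:]) = 1" by (simp add: lead_coeff_prod)
      ultimately show "Polynomial.coeff (\<Prod>i<n. [:- t i, 1:]) n = 1" by simp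
    qed
    \<comment> \<open>Both have degree at most \<open>n\<close>, the same coefficient at
      \<open>n\<close>, and the \<open>n\<close> roots \<open>t i\<close>: putting an earlier node
      in the last column repeats a column.\<close>
    have "R = S"
    proof (rule poly_eqI_degree_lead_coeff)
      have "Polynomial.coeff (q i) n = 0" if "i < n" for i
        using that Suc.prems[of i] by (intro coeff_eq_0) simp
      then have "Polynomial.coeff R n = c n * Polynomial.coeff (q n) n" by (simp add: R_def coeff_sum)
      then show "Polynomial.coeff R n = Polynomial.coeff S n"
        using Suc.prems[of n] monic by (simp add: S_def)
      show "n \<le> card (t ` {..<n})" using True by (simp add: card_image)
      show "degree R \<le> n" unfolding R_def
        using Suc.prems by (intro degree_sum_le) (auto intro!: order.trans[OF degree_smult_le])
      show "degree S \<le> n" unfolding S_def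
        using monic degree_smult_le[of _ "\<Prod>i<n. [:- t i, 1:]"] by simp
    next
      fix z assume "z \<in> t ` {..<n}"
      then obtain i where i: "i < n" "z = t i" by auto
      have "col (A (t(n := z))) i = col (A (t(n := z))) n"
        using i by (auto simp: A_def col_def)
      then have "det (A (t(n := z))) = 0"
        using det_identical_columns[OF A, of i n "t(n := z)"] i by simp
      moreover have "poly S z = 0"
        using i by (auto simp: S_def poly_prod intro!: prod_zero)
      ultimately show "poly R z = poly S z" using expand by (simp add: R_def)
    qed
    then have "det (A t) = poly S (t n)"
      using expand[of "t n"] by (simp add: R_def)
    also have "\<dots> = c n * lead_coeff (q n) * (\<Prod>i<n. t n - t i)"
      by (simp add: S_def poly_prod)
    finally show ?thesis using cn by (simp add: A_def)
  qed
qed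

section \<open>Sums over configurations of squared determinants\<close>

lemma has_sum_prod_PiE:
  fixes f :: "'a \<Rightarrow> 'b::countable \<Rightarrow> real"
  assumes "finite A" and "\<And>x. x \<in> A \<Longrightarrow> (f x has_sum S x) UNIV"
  shows "((\<lambda>g. \<Prod>x\<in>A. f x (g x)) has_sum (\<Prod>x\<in>A. S x)) (PiE A (\<lambda>_. UNIV))"
proof -
  \<comment> \<open>Summability of a real family is unconditional, hence absolute, which is the form
    that the product rules for sums over \<open>PiE\<close> require.\<close>
  have abs: "Infinite_Sum.abs_summable_on (f x) UNIV" if "x \<in> A" for x
    by (rule summable_on_iff_abs_summable_on_real[THEN iffD1, OF has_sum_imp_summable[OF assms(2)[OF that]]])
  have "(\<lambda>g. \<Prod>x\<in>A. f x (g x)) summable_on (PiE A (\<lambda>_. UNIV))"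
  proof (rule abs_summable_summable)
    show "Infinite_Sum.abs_summable_on (\<lambda>g. \<Prod>x\<in>A. f x (g x)) (PiE A (\<lambda>_. UNIV))"
      unfolding abs_summable_equivalent
      by (rule abs_summable_on_prod_PiE[OF assms(1) countableI_type abs[unfolded abs_summable_equivalent]])
  qed
  moreover have "infsum (\<lambda>g. \<Prod>x\<in>A. f x (g x)) (PiE A (\<lambda>_. UNIV)) = (\<Prod>x\<in>A. infsum (f x) UNIV)"
    by (rule infsum_prod_PiE_abs[OF assms(1) abs])
  ultimately show ?thesis
    using infsumI[OF assms(2)] by (simp add: has_sum_iff)
qed

text \<open>Used with \<open>T\<close> a singleton, where it forces equality, and with
  \<open>T\<close> a pair, where it leaves only a swap.\<close>

lemma permutes_agree_outside:
  assumes "\<sigma> permutes S" "\<tau> permutes S"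
    and "\<And>k. k \<in> S - T \<Longrightarrow> \<sigma> k = \<tau> k"
  obtains \<rho> where "\<rho> permutes T" "\<sigma> = \<tau> \<circ> \<rho>"
proof
  define \<rho> where "\<rho> = inv_into UNIV \<tau> \<circ> \<sigma>"
  show "\<sigma> = \<tau> \<circ> \<rho>"
    using permutes_inv_o(1)[OF assms(2)] by (simp add: \<rho>_def o_assoc)
  have \<rho>: "\<rho> permutes S"
    unfolding \<rho>_def using assms(1,2) permutes_compose permutes_inv by blast
  have "\<rho> k = k" if "k \<notin> T" for k
  proof (cases "k \<in> S")
    case True
    then show ?thesis using assms(3)[of k] that permutes_inverses(2)[OF assms(2)]
      by (simp add: \<rho>_def)
  next
    case False
    then show ?thesis using \<rho> by (simp add: permutes_def)
  qed
  then show "\<rho> permutes T"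
    using \<rho> by (auto simp: permutes_def)
qed

lemma has_sum_sum:
  fixes f :: "'i \<Rightarrow> 'a \<Rightarrow> 'b::{topological_comm_monoid_add}"
  assumes "\<And>i. i \<in> I \<Longrightarrow> (f i has_sum S i) A"
  shows "((\<lambda>x. \<Sum>i\<in>I. f i x) has_sum (\<Sum>i\<in>I. S i)) A"
  using assms by (induction I rule: infinite_finite_induct) (auto intro!: has_sum_add)

text \<open>After expanding both determinants, each pair of permutations contributes a product over
  the sites, so the sum over configurations factors. The factor \<open>g\<close> depends on the site
  in order to mark one or two of them with the test function.\<close>

lemma has_sum_det_square:
  fixes r :: "nat \<Rightarrow> int \<Rightarrow> real"
  assumes "\<And>i k l. i < n \<Longrightarrow> k < n \<Longrightarrow> l < n \<Longrightarrow>
    ((\<lambda>y. g i y * r k y * r l y * w y) has_sum G i k l) UNIV"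
  shows "((\<lambda>z. (\<Prod>i=0..<n. g i (z i)) * ((det (mat n n (\<lambda>(i, j). r j (z i))))\<^sup>2 * (\<Prod>i=0..<n. w (z i))))
    has_sum (\<Sum>\<sigma> | \<sigma> permutes {0..<n}. \<Sum>\<tau> | \<tau> permutes {0..<n}.
      signof \<sigma> * signof \<tau> * (\<Prod>i=0..<n. G i (\<sigma> i) (\<tau> i)))) (PiE {0..<n} (\<lambda>_. UNIV))"
proof -
  have "((\<lambda>z. \<Sum>\<sigma> | \<sigma> permutes {0..<n}. \<Sum>\<tau> | \<tau> permutes {0..<n}.
      signof \<sigma> * signof \<tau> * (\<Prod>i=0..<n. g i (z i) * r (\<sigma> i) (z i) * r (\<tau> i) (z i) * w (z i)))
    has_sum (\<Sum>\<sigma> | \<sigma> permutes {0..<n}. \<Sum>\<tau> | \<tau> permutes {0..<n}.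
      signof \<sigma> * signof \<tau> * (\<Prod>i=0..<n. G i (\<sigma> i) (\<tau> i)))) (PiE {0..<n} (\<lambda>_. UNIV))"
  proof (intro has_sum_sum has_sum_cmult_right)
    fix \<sigma> \<tau> assume "\<sigma> \<in> {\<sigma>. \<sigma> permutes {0..<n}}" "\<tau> \<in> {\<tau>. \<tau> permutes {0..<n}}"
    then have "\<sigma> i < n" "\<tau> i < n" if "i < n" for i
      using that permutes_in_image[of _ "{0..<n}" i] by auto
    then show "((\<lambda>z. \<Prod>i=0..<n. g i (z i) * r (\<sigma> i) (z i) * r (\<tau> i) (z i) * w (z i))
        has_sum (\<Prod>i=0..<n. G i (\<sigma> i) (\<tau> i))) (PiE {0..<n} (\<lambda>_. UNIV))"
      using assms by (intro has_sum_prod_PiE[where f = "\<lambda>i y. g i y * r (\<sigma> i) y * r (\<tau> i) y * w y"]) auto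
  qed
  moreover have "(\<Sum>\<sigma> | \<sigma> permutes {0..<n}. \<Sum>\<tau> | \<tau> permutes {0..<n}.
      signof \<sigma> * signof \<tau> * (\<Prod>i=0..<n. g i (z i) * r (\<sigma> i) (z i) * r (\<tau> i) (z i) * w (z i)))
    = (\<Prod>i=0..<n. g i (z i)) * ((det (mat n n (\<lambda>(i, j). r j (z i))))\<^sup>2 * (\<Prod>i=0..<n. w (z i)))" for z
  proof -
    have "det (mat n n (\<lambda>(i, j). r j (z i))) =
        (\<Sum>\<sigma> | \<sigma> permutes {0..<n}. signof \<sigma> * (\<Prod>i=0..<n. r (\<sigma> i) (z i)))"
      by (subst det_def'[of _ n])
        (auto intro!: sum.cong prod.cong dest: permutes_in_image[of _ "{0..<n}"])
    then have "(det (mat n n (\<lambda>(i, j). r j (z i))))\<^sup>2 =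
        (\<Sum>\<sigma> | \<sigma> permutes {0..<n}. \<Sum>\<tau> | \<tau> permutes {0..<n}.
          (signof \<sigma> * (\<Prod>i=0..<n. r (\<sigma> i) (z i))) * (signof \<tau> * (\<Prod>i=0..<n. r (\<tau> i) (z i))))"
      by (simp only: power2_eq_square sum_product)
    then show ?thesis
      by (simp add: sum_distrib_left sum_distrib_right prod.distrib mult_ac)
  qed
  ultimately show ?thesis by simp
qed

lemma signof_square: "signof p * signof p = (1 :: real)"
  by (simp add: sign_def)

text \<open>The factors \<open>of_bool\<close> are the orthonormality relations at the unmarked
  sites. A permutation is determined by its values off one site, so only
  \<open>\<tau> = \<sigma>\<close> survives.\<close>

lemma sum_permutations_single:
  fixes F :: "nat \<Rightarrow> nat \<Rightarrow> real"
  assumes "i < n"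
  shows "(\<Sum>\<sigma> | \<sigma> permutes {0..<n}. \<Sum>\<tau> | \<tau> permutes {0..<n}. signof \<sigma> * signof \<tau> *
      (\<Prod>j=0..<n. if j = i then F (\<sigma> j) (\<tau> j) else of_bool (\<sigma> j = \<tau> j))) =
    (\<Sum>\<sigma> | \<sigma> permutes {0..<n}. F (\<sigma> i) (\<sigma> i))"
proof (rule sum.cong[OF refl])
  fix \<sigma> assume "\<sigma> \<in> {\<sigma>. \<sigma> permutes {0..<n}}"
  then have \<sigma>: "\<sigma> permutes {0..<n}" by simp
  define h where "h \<tau> = signof \<sigma> * signof \<tau> *
      (\<Prod>j=0..<n. if j = i then F (\<sigma> j) (\<tau> j) else of_bool (\<sigma> j = \<tau> j))" for \<tau>
  have "h \<tau> = 0" if \<tau>: "\<tau> permutes {0..<n}" "\<tau> \<noteq> \<sigma>" for \<tau>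
  proof -
    have "\<exists>j\<in>{0..<n} - {i}. \<sigma> j \<noteq> \<tau> j"
    proof (rule ccontr)
      assume "\<not> ?thesis"
      then obtain \<rho> where "\<rho> permutes {i}" "\<sigma> = \<tau> \<circ> \<rho>"
        using permutes_agree_outside[OF \<sigma> \<tau>(1), of "{i}"] by blast
      then show False using \<tau>(2) by simp
    qed
    then have "(\<Prod>j=0..<n. if j = i then F (\<sigma> j) (\<tau> j) else of_bool (\<sigma> j = \<tau> j)) = 0"
      by (intro prod_zero) auto
    then show ?thesis by (simp add: h_def)
  qed
  then have "(\<Sum>\<tau> | \<tau> permutes {0..<n}. h \<tau>) = (\<Sum>\<tau>\<in>{\<sigma>}. h \<tau>)"
    using \<sigma> by (intro sum.mono_neutral_right) (auto simp: finite_permutations)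
  also have "\<dots> = F (\<sigma> i) (\<sigma> i)"
  proof -
    have "(\<Prod>j=0..<n. if j = i then F (\<sigma> j) (\<sigma> j) else of_bool (\<sigma> j = \<sigma> j)) =
        (\<Prod>j=0..<n. if j = i then F (\<sigma> j) (\<sigma> j) else 1)"
      by (intro prod.cong) auto
    then show ?thesis using assms by (simp add: h_def signof_square)
  qed
  finally show "(\<Sum>\<tau> | \<tau> permutes {0..<n}. signof \<sigma> * signof \<tau> *
      (\<Prod>j=0..<n. if j = i then F (\<sigma> j) (\<tau> j) else of_bool (\<sigma> j = \<tau> j))) = F (\<sigma> i) (\<sigma> i)"
    by (simp add: h_def)
qed

text \<open>With two unconstrained sites, \<tau> is either \<sigma> or \<sigma> composed with the
  swap of these sites. The swap reverses the sign, and the two survivors form a 2 by 2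
  determinant.\<close>

lemma sum_permutations_pair:
  fixes F :: "nat \<Rightarrow> nat \<Rightarrow> real"
  assumes "i < n" "i' < n" "i \<noteq> i'"
  shows "(\<Sum>\<sigma> | \<sigma> permutes {0..<n}. \<Sum>\<tau> | \<tau> permutes {0..<n}. signof \<sigma> * signof \<tau> *
      (\<Prod>j=0..<n. if j \<in> {i, i'} then F (\<sigma> j) (\<tau> j) else of_bool (\<sigma> j = \<tau> j))) =
    (\<Sum>\<sigma> | \<sigma> permutes {0..<n}.
      F (\<sigma> i) (\<sigma> i) * F (\<sigma> i') (\<sigma> i') - F (\<sigma> i) (\<sigma> i') * F (\<sigma> i') (\<sigma> i))"
proof (rule sum.cong[OF refl])
  fix \<sigma> assume "\<sigma> \<in> {\<sigma>. \<sigma> permutes {0..<n}}"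
  then have \<sigma>: "\<sigma> permutes {0..<n}" by simp
  define u where "u = Transposition.transpose i i'"
  have u: "u permutes {0..<n}" "u i = i'" "u i' = i" "\<And>j. j \<noteq> i \<Longrightarrow> j \<noteq> i' \<Longrightarrow> u j = j"
    using assms by (auto simp: u_def permutes_swap_id transpose_eq_id_iff)
  have sign: "signof (\<sigma> \<circ> u) = (- signof \<sigma> :: real)"
    using permutation_permutes \<sigma> assms
    by (subst sign_compose) (auto simp: u_def sign_swap_id permutation_swap_id)
  have ne: "\<sigma> \<circ> u \<noteq> \<sigma>"
    using u(3) assms(3) permutes_inj[OF \<sigma>] by (metis comp_apply injD)
  define h where "h \<tau> = signof \<sigma> * signof \<tau> *
      (\<Prod>j=0..<n. if j \<in> {i, i'} then F (\<sigma> j) (\<tau> j) else of_bool (\<sigma> j = \<tau> j))" for \<tau>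
  have split: "{0..<n} = insert i (insert i' ({0..<n} - {i, i'}))"
    using assms by auto
  have h: "h \<tau> = signof \<sigma> * signof \<tau> * (F (\<sigma> i) (\<tau> i) * F (\<sigma> i') (\<tau> i'))"
    if "\<And>j. j \<noteq> i \<Longrightarrow> j \<noteq> i' \<Longrightarrow> \<tau> j = \<sigma> j" for \<tau>
    unfolding h_def using assms that by (subst split) simp
  have "h \<tau> = 0" if \<tau>: "\<tau> permutes {0..<n}" "\<tau> \<noteq> \<sigma>" "\<tau> \<noteq> \<sigma> \<circ> u" for \<tau>
  proof -
    have "\<exists>j\<in>{0..<n} - {i, i'}. \<sigma> j \<noteq> \<tau> j"
    proof (rule ccontr)
      assume "\<not> ?thesis"
      then obtain \<rho> where "\<rho> permutes {i, i'}" "\<tau> = \<sigma> \<circ> \<rho>"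
        using permutes_agree_outside[OF \<tau>(1) \<sigma>, of "{i, i'}"] by metis
      then show False using \<tau>(2,3) by (auto simp: permutes_doubleton_iff u_def)
    qed
    then have "(\<Prod>j=0..<n. if j \<in> {i, i'} then F (\<sigma> j) (\<tau> j) else of_bool (\<sigma> j = \<tau> j)) = 0"
      by (intro prod_zero) auto
    then show ?thesis by (simp add: h_def)
  qed
  then have "(\<Sum>\<tau> | \<tau> permutes {0..<n}. h \<tau>) = (\<Sum>\<tau>\<in>{\<sigma>, \<sigma> \<circ> u}. h \<tau>)"
    using \<sigma> u(1) by (intro sum.mono_neutral_right) (auto simp: finite_permutations permutes_compose)
  also have "\<dots> = h \<sigma> + h (\<sigma> \<circ> u)"
    using ne by auto
  also have "\<dots> = F (\<sigma> i) (\<sigma> i) * F (\<sigma> i') (\<sigma> i') - F (\<sigma> i) (\<sigma> i') * F (\<sigma> i') (\<sigma> i)"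
  proof -
    have "h \<sigma> = F (\<sigma> i) (\<sigma> i) * F (\<sigma> i') (\<sigma> i')"
      by (subst h) (simp_all add: signof_square)
    moreover have "h (\<sigma> \<circ> u) = - (F (\<sigma> i) (\<sigma> i') * F (\<sigma> i') (\<sigma> i))"
      by (subst h) (simp_all add: sign u signof_square)
    ultimately show ?thesis by simp
  qed
  finally show "(\<Sum>\<tau> | \<tau> permutes {0..<n}. signof \<sigma> * signof \<tau> *
      (\<Prod>j=0..<n. if j \<in> {i, i'} then F (\<sigma> j) (\<tau> j) else of_bool (\<sigma> j = \<tau> j))) =
      F (\<sigma> i) (\<sigma> i) * F (\<sigma> i') (\<sigma> i') - F (\<sigma> i) (\<sigma> i') * F (\<sigma> i') (\<sigma> i)"
    by (simp only: h_def)
qed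

text \<open>For a fixed permutation the sum over sites merely reorders the trace, and there are
  \<open>fact n\<close> permutations.\<close>

lemma sum_permutations_trace:
  fixes f :: "nat \<Rightarrow> real"
  shows "(\<Sum>i=0..<n. \<Sum>\<sigma> | \<sigma> permutes {0..<n}. f (\<sigma> i)) = fact n * (\<Sum>k=0..<n. f k)"
proof -
  have "(\<Sum>i=0..<n. f (\<sigma> i)) = (\<Sum>k=0..<n. f k)" if "\<sigma> permutes {0..<n}" for \<sigma>
    using sum.permute[OF that, of f] by (simp add: o_def)
  then show ?thesis
    by (subst sum.swap) (simp add: card_permutations)
qed

text \<open>In the double sum over sites, equal sites give matrix elements of the squared function
  and distinct sites give 2 by 2 determinants of \<open>F\<close>. The matrix \<open>FF\<close> is a
  separate datum because multiplication by \<open>f\<close> leaves the span of the first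
  \<open>n\<close> functions, so \<open>FF\<close> is not the square of the truncated
  \<open>F\<close>.\<close>

lemma det_ensemble_moments:
  fixes r :: "nat \<Rightarrow> int \<Rightarrow> real" and f w :: "int \<Rightarrow> real"
  assumes orth: "\<And>k l. k < n \<Longrightarrow> l < n \<Longrightarrow> ((\<lambda>y. r k y * r l y * w y) has_sum of_bool (k = l)) UNIV"
    and F: "\<And>k l. k < n \<Longrightarrow> l < n \<Longrightarrow> ((\<lambda>y. f y * r k y * r l y * w y) has_sum F k l) UNIV"
    and FF: "\<And>k l. k < n \<Longrightarrow> l < n \<Longrightarrow> ((\<lambda>y. (f y)\<^sup>2 * r k y * r l y * w y) has_sum FF k l) UNIV"
  defines "W \<equiv> \<lambda>z. (det (mat n n (\<lambda>(i, j). r j (z i))))\<^sup>2 * (\<Prod>i=0..<n. w (z i))"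
    and "Z \<equiv> PiE {0..<n} (\<lambda>_. UNIV)"
    and "X \<equiv> \<lambda>z. \<Sum>i=0..<n. f (z i)"
    and "T \<equiv> \<Sum>k=0..<n. F k k"
  shows "(W has_sum fact n) Z"
    and "((\<lambda>z. (X z - T)\<^sup>2 * W z) has_sum
           fact n * ((\<Sum>k=0..<n. FF k k) - (\<Sum>k=0..<n. \<Sum>l=0..<n. F k l * F l k))) Z"
proof -
  let ?P = "{\<sigma>. \<sigma> permutes {0..<n}}"
  have single: "((\<lambda>z. h (z i) * W z) has_sum (\<Sum>\<sigma>\<in>?P. H (\<sigma> i) (\<sigma> i))) Z"
    if "i < n" and H: "\<And>k l. k < n \<Longrightarrow> l < n \<Longrightarrow> ((\<lambda>y. h y * r k y * r l y * w y) has_sum H k l) UNIV"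
    for i h H
  proof -
    have "((\<lambda>z. (\<Prod>j=0..<n. (if j = i then h (z j) else 1)) * W z) has_sum
      (\<Sum>\<sigma>\<in>?P. \<Sum>\<tau>\<in>?P. signof \<sigma> * signof \<tau> *
        (\<Prod>j=0..<n. if j = i then H (\<sigma> j) (\<tau> j) else of_bool (\<sigma> j = \<tau> j)))) Z"
      unfolding W_def Z_def using orth H
      by (intro has_sum_det_square[where g = "\<lambda>j y. if j = i then h y else 1"
          and G = "\<lambda>j k l. if j = i then H k l else of_bool (k = l)"]) auto
    then show ?thesis
      using \<open>i < n\<close> by (simp add: sum_permutations_single)
  qed
  have pair: "((\<lambda>z. f (z i) * f (z i') * W z) has_sum
      (\<Sum>\<sigma>\<in>?P. F (\<sigma> i) (\<sigma> i) * F (\<sigma> i') (\<sigma> i') - F (\<sigma> i) (\<sigma> i') * F (\<sigma> i') (\<sigma> i))) Z"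
    if "i < n" "i' < n" "i \<noteq> i'" for i i'
  proof -
    have "((\<lambda>z. (\<Prod>j=0..<n. (if j \<in> {i, i'} then f (z j) else 1)) * W z) has_sum
      (\<Sum>\<sigma>\<in>?P. \<Sum>\<tau>\<in>?P. signof \<sigma> * signof \<tau> *
        (\<Prod>j=0..<n. if j \<in> {i, i'} then F (\<sigma> j) (\<tau> j) else of_bool (\<sigma> j = \<tau> j)))) Z"
      unfolding W_def Z_def using orth F
      by (intro has_sum_det_square[where g = "\<lambda>j y. if j \<in> {i, i'} then f y else 1"
          and G = "\<lambda>j k l. if j \<in> {i, i'} then F k l else of_bool (k = l)"]) auto
    moreover have "(\<Prod>j=0..<n. (if j \<in> {i, i'} then f (z j) else 1)) = f (z i) * f (z i')" for z
    proof -
      have "(\<Prod>j=0..<n. (if j \<in> {i, i'} then f (z j) else 1)) = (\<Prod>j\<in>{i, i'}. f (z j))"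
        using that by (intro prod.mono_neutral_cong_right) auto
      then show ?thesis using that by simp
    qed
    ultimately show ?thesis
      using sum_permutations_pair[OF that, of F] by simp
  qed
  have "(W has_sum (\<Sum>\<sigma>\<in>?P. \<Sum>\<tau>\<in>?P. signof \<sigma> * signof \<tau> * (\<Prod>i=0..<n. of_bool (\<sigma> i = \<tau> i)))) Z"
    using has_sum_det_square[where g = "\<lambda>_ _. 1" and G = "\<lambda>_ k l. of_bool (k = l)" and r = r and w = w and n = n]
      orth by (simp add: W_def Z_def)
  moreover have "(\<Sum>\<sigma>\<in>?P. \<Sum>\<tau>\<in>?P. signof \<sigma> * signof \<tau> * (\<Prod>i=0..<n. of_bool (\<sigma> i = \<tau> i))) = (fact n :: real)"
  proof -
    have "(\<Sum>\<tau>\<in>?P. signof \<sigma> * signof \<tau> * (\<Prod>i=0..<n. of_bool (\<sigma> i = \<tau> i))) = (1 :: real)"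
      if "\<sigma> permutes {0..<n}" for \<sigma>
    proof -
      have "(\<Prod>i=0..<n. of_bool (\<sigma> i = \<tau> i)) = (0::real)" if "\<tau> permutes {0..<n}" "\<tau> \<noteq> \<sigma>" for \<tau>
      proof -
        have "\<exists>i\<in>{0..<n}. \<sigma> i \<noteq> \<tau> i"
          using that \<open>\<sigma> permutes {0..<n}\<close> by (metis ext permutes_not_in)
        then show ?thesis by (intro prod_zero) auto
      qed
      then have "(\<Sum>\<tau>\<in>?P. signof \<sigma> * signof \<tau> * (\<Prod>i=0..<n. of_bool (\<sigma> i = \<tau> i)))
          = (\<Sum>\<tau>\<in>{\<sigma>}. signof \<sigma> * signof \<tau> * (\<Prod>i=0..<n. of_bool (\<sigma> i = \<tau> i)) :: real)"
        using that by (intro sum.mono_neutral_right) (auto simp: finite_permutations)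
      then show ?thesis by (simp add: signof_square)
    qed
    then show ?thesis by (simp add: card_permutations)
  qed
  ultimately show W: "(W has_sum fact n) Z" by simp
  have X1: "((\<lambda>z. \<Sum>i=0..<n. f (z i) * W z) has_sum (\<Sum>i=0..<n. \<Sum>\<sigma>\<in>?P. F (\<sigma> i) (\<sigma> i))) Z"
    by (intro has_sum_sum single F) auto
  have X2: "((\<lambda>z. \<Sum>i=0..<n. \<Sum>i'=0..<n. f (z i) * f (z i') * W z) has_sum
      (\<Sum>i=0..<n. \<Sum>i'=0..<n. if i = i' then (\<Sum>\<sigma>\<in>?P. FF (\<sigma> i) (\<sigma> i)) else
         (\<Sum>\<sigma>\<in>?P. F (\<sigma> i) (\<sigma> i) * F (\<sigma> i') (\<sigma> i') - F (\<sigma> i) (\<sigma> i') * F (\<sigma> i') (\<sigma> i)))) Z"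
  proof (intro has_sum_sum)
    fix i i' assume "i \<in> {0..<n}" "i' \<in> {0..<n}"
    then show "((\<lambda>z. f (z i) * f (z i') * W z) has_sum
        (if i = i' then (\<Sum>\<sigma>\<in>?P. FF (\<sigma> i) (\<sigma> i)) else
         (\<Sum>\<sigma>\<in>?P. F (\<sigma> i) (\<sigma> i) * F (\<sigma> i') (\<sigma> i') - F (\<sigma> i) (\<sigma> i') * F (\<sigma> i') (\<sigma> i)))) Z"
    proof (cases "i = i'")
      case True
      then show ?thesis
        using single[of i "\<lambda>y. (f y)\<^sup>2" FF] FF \<open>i \<in> {0..<n}\<close> by (simp add: power2_eq_square)
    next
      case False
      then show ?thesis
        using pair[of i i'] \<open>i \<in> {0..<n}\<close> \<open>i' \<in> {0..<n}\<close> by simp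
    qed
  qed
  have E2: "(\<Sum>i=0..<n. \<Sum>i'=0..<n. if i = i' then (\<Sum>\<sigma>\<in>?P. FF (\<sigma> i) (\<sigma> i)) else
         (\<Sum>\<sigma>\<in>?P. F (\<sigma> i) (\<sigma> i) * F (\<sigma> i') (\<sigma> i') - F (\<sigma> i) (\<sigma> i') * F (\<sigma> i') (\<sigma> i)))
     = fact n * ((\<Sum>k=0..<n. FF k k) + T\<^sup>2 - (\<Sum>k=0..<n. \<Sum>l=0..<n. F k l * F l k))"
    (is "?L = _")
  proof -
    define H where "H k l = F k k * F l l - F k l * F l k" for k l
    have "?L = (\<Sum>i=0..<n. \<Sum>i'=0..<n.
        (if i = i' then (\<Sum>\<sigma>\<in>?P. FF (\<sigma> i) (\<sigma> i)) else 0) + (\<Sum>\<sigma>\<in>?P. H (\<sigma> i) (\<sigma> i')))"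
      by (intro sum.cong refl) (auto simp: H_def)
    also have "\<dots> = (\<Sum>i=0..<n. \<Sum>\<sigma>\<in>?P. FF (\<sigma> i) (\<sigma> i)) +
        (\<Sum>i=0..<n. \<Sum>i'=0..<n. \<Sum>\<sigma>\<in>?P. H (\<sigma> i) (\<sigma> i'))"
      by (simp add: sum.distrib)
    also have "(\<Sum>i=0..<n. \<Sum>i'=0..<n. \<Sum>\<sigma>\<in>?P. H (\<sigma> i) (\<sigma> i')) =
        (\<Sum>i=0..<n. \<Sum>\<sigma>\<in>?P. \<Sum>l=0..<n. H (\<sigma> i) l)"
    proof (rule sum.cong[OF refl])
      fix i
      have "(\<Sum>i'=0..<n. H (\<sigma> i) (\<sigma> i')) = (\<Sum>l=0..<n. H (\<sigma> i) l)" if "\<sigma> permutes {0..<n}" for \<sigma>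
        using sum.permute[OF that, of "H (\<sigma> i)"] by (simp add: o_def)
      then show "(\<Sum>i'=0..<n. \<Sum>\<sigma>\<in>?P. H (\<sigma> i) (\<sigma> i')) = (\<Sum>\<sigma>\<in>?P. \<Sum>l=0..<n. H (\<sigma> i) l)"
        by (subst sum.swap) simp
    qed
    also have "\<dots> = fact n * (\<Sum>k=0..<n. \<Sum>l=0..<n. H k l)"
      by (rule sum_permutations_trace)
    also have "(\<Sum>k=0..<n. \<Sum>l=0..<n. H k l) = T\<^sup>2 - (\<Sum>k=0..<n. \<Sum>l=0..<n. F k l * F l k)"
      by (simp add: H_def T_def power2_eq_square sum_product sum_subtractf)
    finally show ?thesis
      using sum_permutations_trace[of "\<lambda>k. FF k k" n] by (simp add: algebra_simps)
  qed
  have E1: "(\<Sum>i=0..<n. \<Sum>\<sigma>\<in>?P. F (\<sigma> i) (\<sigma> i)) = fact n * T"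
    using sum_permutations_trace[of "\<lambda>k. F k k" n] by (simp add: T_def)
  have "((\<lambda>z. (\<Sum>i=0..<n. \<Sum>i'=0..<n. f (z i) * f (z i') * W z)
        + (- 2 * T) * (\<Sum>i=0..<n. f (z i) * W z) + T\<^sup>2 * W z) has_sum
      (fact n * ((\<Sum>k=0..<n. FF k k) + T\<^sup>2 - (\<Sum>k=0..<n. \<Sum>l=0..<n. F k l * F l k))
        + (- 2 * T) * (fact n * T) + T\<^sup>2 * fact n)) Z"
    using X1 X2 W unfolding E1 E2 by (intro has_sum_add has_sum_cmult_right)
  moreover have "(\<Sum>i=0..<n. \<Sum>i'=0..<n. f (z i) * f (z i') * W z)
        + (- 2 * T) * (\<Sum>i=0..<n. f (z i) * W z) + T\<^sup>2 * W z = (X z - T)\<^sup>2 * W z" for z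
  proof -
    have "(\<Sum>i=0..<n. \<Sum>i'=0..<n. f (z i) * f (z i') * W z) = (X z)\<^sup>2 * W z"
      by (simp only: X_def power2_eq_square sum_product) (simp only: sum_distrib_right)
    moreover have "(\<Sum>i=0..<n. f (z i) * W z) = X z * W z"
      by (simp add: X_def sum_distrib_right)
    ultimately show ?thesis by (simp add: power2_eq_square algebra_simps)
  qed
  moreover have "fact n * ((\<Sum>k=0..<n. FF k k) + T\<^sup>2 - (\<Sum>k=0..<n. \<Sum>l=0..<n. F k l * F l k))
        + (- 2 * T) * (fact n * T) + T\<^sup>2 * fact n =
        fact n * ((\<Sum>k=0..<n. FF k k) - (\<Sum>k=0..<n. \<Sum>l=0..<n. F k l * F l k))"
    by (simp add: power2_eq_square algebra_simps)
  ultimately show "((\<lambda>z. (X z - T)\<^sup>2 * W z) has_sum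
           fact n * ((\<Sum>k=0..<n. FF k k) - (\<Sum>k=0..<n. \<Sum>l=0..<n. F k l * F l k))) Z"
    by simp
qed


section \<open>From configurations to the random points\<close>

lemma det_poly_eval_cols:
  fixes q :: "nat \<Rightarrow> real poly"
  assumes "\<And>i. i < n \<Longrightarrow> degree (q i) = i"
  shows "det (mat n n (\<lambda>(i, j). poly (q j) (t i))) =
    (\<Prod>i<n. lead_coeff (q i)) * (\<Prod>j<n. \<Prod>i<j. t j - t i)"
proof -
  have "transpose_mat (mat n n (\<lambda>(i, j). poly (q i) (t j))) = mat n n (\<lambda>(i, j). poly (q j) (t i))"
    by (intro eq_matI) auto
  then show ?thesis
    using det_transpose[of "mat n n (\<lambda>(i, j). poly (q i) (t j))" n] det_poly_eval[of n q t] assms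
    by simp
qed

lemma lattice_int_of_int:
  "n \<ge> 1 \<Longrightarrow> lattice_int n (of_int k / real n) = k"
  by (simp add: lattice_int_def)

text \<open>Replacing monomials by polynomials of the same degrees multiplies the Vandermonde
  determinant by the leading coefficients only. The configuration \<open>z\<close> numbers sites
  from 0, the ensemble from 1, hence the shift \<open>j - 1\<close>.\<close>

lemma ensemble_weight_eq_det:
  fixes q :: "nat \<Rightarrow> real poly"
  assumes "n \<ge> 1" and "\<And>i. i < n \<Longrightarrow> degree (q i) = i"
  shows "(\<Prod>i<n. lead_coeff (q i))\<^sup>2 * ensemble_weight \<nu> w n (\<lambda>j. of_int (z (j - 1)) / real n) =
    (det (mat n n (\<lambda>(i, j). poly (q j) (\<nu> (z i)))))\<^sup>2 * (\<Prod>i=0..<n. w (z i))"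
proof -
  have "(\<Prod>(i, j) \<in> {(i, j). 1 \<le> i \<and> i < j \<and> j \<le> n}. (\<nu> (z (i - 1)) - \<nu> (z (j - 1)))\<^sup>2) =
      (\<Prod>(j, i) \<in> (SIGMA j:{..<n}. {..<j}). (\<nu> (z j) - \<nu> (z i))\<^sup>2)"
    by (rule prod.reindex_bij_witness[of _ "\<lambda>(j, i). (Suc i, Suc j)" "\<lambda>(i, j). (j - 1, i - 1)"])
      (auto simp: power2_commute)
  also have "\<dots> = (\<Prod>j<n. \<Prod>i<j. \<nu> (z j) - \<nu> (z i))\<^sup>2"
    by (simp add: prod.Sigma[symmetric] prod_power_distrib)
  finally have V: "(\<Prod>(i, j) \<in> {(i, j). 1 \<le> i \<and> i < j \<and> j \<le> n}. (\<nu> (z (i - 1)) - \<nu> (z (j - 1)))\<^sup>2) =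
     (\<Prod>j<n. \<Prod>i<j. \<nu> (z j) - \<nu> (z i))\<^sup>2" .
  have w: "(\<Prod>j=1..n. w (z (j - 1))) = (\<Prod>i=0..<n. w (z i))"
    by (rule prod.reindex_bij_witness[of _ Suc "\<lambda>j. j - 1"]) auto
  show ?thesis
    using assms V w det_poly_eval_cols[of n q "\<lambda>i. \<nu> (z i)"]
    by (simp add: ensemble_weight_def \<mu>_of_def lattice_int_of_int power_mult_distrib)
qed

text \<open>Tonelli for \<open>M\<close> and counting measure. Only the fibres of \<open>Y\<close>
  have to be measurable, so the tuples that serve as values need no sigma-algebra; the nonnegative
  integral spares a separate proof of integrability.\<close>

lemma nn_integral_discrete:
  assumes "countable S" and "\<And>\<omega>. \<omega> \<in> space M \<Longrightarrow> Y \<omega> \<in> S"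
    and meas: "\<And>z. z \<in> S \<Longrightarrow> {\<omega> \<in> space M. Y \<omega> = z} \<in> sets M"
    and "finite_measure M"
    and pos: "\<And>z. z \<in> S \<Longrightarrow> 0 \<le> g z"
    and sum: "((\<lambda>z. g z * measure M {\<omega> \<in> space M. Y \<omega> = z}) has_sum E) S"
  shows "(\<integral>\<^sup>+\<omega>. ennreal (g (Y \<omega>)) \<partial>M) = ennreal E"
proof -
  interpret finite_measure M by fact
  define A where "A z = {\<omega> \<in> space M. Y \<omega> = z}" for z
  have "(\<integral>\<^sup>+\<omega>. ennreal (g (Y \<omega>)) \<partial>M) =
      (\<integral>\<^sup>+\<omega>. (\<integral>\<^sup>+z. ennreal (g z) * indicator (A z) \<omega> \<partial>count_space S) \<partial>M)"
  proof (rule nn_integral_cong)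
    fix \<omega> assume \<omega>: "\<omega> \<in> space M"
    have "(\<integral>\<^sup>+z. ennreal (g z) * indicator (A z) \<omega> \<partial>count_space S) =
        (\<Sum>z\<in>{Y \<omega>}. ennreal (g z) * indicator (A z) \<omega>)"
      using assms(2) \<omega> by (intro nn_integral_count_space') (auto simp: A_def)
    then show "ennreal (g (Y \<omega>)) = (\<integral>\<^sup>+z. ennreal (g z) * indicator (A z) \<omega> \<partial>count_space S)"
      using \<omega> by (simp add: A_def)
  qed
  also have "\<dots> = (\<integral>\<^sup>+z. (\<integral>\<^sup>+\<omega>. ennreal (g z) * indicator (A z) \<omega> \<partial>M) \<partial>count_space S)"
    using meas by (intro nn_integral_count_space_nn_integral assms(1)) (auto simp: A_def)
  also have "\<dots> = (\<integral>\<^sup>+z. ennreal (g z * measure M (A z)) \<partial>count_space S)"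
    using meas pos
    by (intro nn_integral_cong) (simp add: A_def nn_integral_cmult_indicator emeasure_eq_measure ennreal_mult')
  also have "\<dots> = ennreal E"
  proof -
    have abs: "Infinite_Set_Sum.abs_summable_on (\<lambda>z. g z * measure M (A z)) S"
      unfolding abs_summable_equivalent[symmetric] A_def
      by (rule summable_on_iff_abs_summable_on_real[THEN iffD1, OF has_sum_imp_summable[OF sum]])
    have "infsetsum (\<lambda>z. g z * measure M (A z)) S = E"
      unfolding infsetsum_infsum[OF abs] using sum by (simp add: A_def infsumI)
    then show ?thesis
      using pos by (subst nn_integral_conv_infsetsum[OF abs]) auto
  qed
  finally show ?thesis .
qed

lemma linear_statistic_second_moment:
  fixes q :: "nat \<Rightarrow> real poly" and \<nu> w :: "int \<Rightarrow> real" and h :: "real \<Rightarrow> real"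
  assumes "prob_space M" "orthogonal_polynomial_ensemble M \<nu> w n x" "n \<ge> 1"
    and deg: "\<And>k. k < n \<Longrightarrow> degree (q k) = k"
    and lc: "\<And>k. k < n \<Longrightarrow> lead_coeff (q k) > 0"
    and orth: "\<And>k l. k < n \<Longrightarrow> l < n \<Longrightarrow>
      ((\<lambda>y. poly (q k) (\<nu> y) * poly (q l) (\<nu> y) * w y) has_sum of_bool (k = l)) UNIV"
    and F: "\<And>k l. k < n \<Longrightarrow> l < n \<Longrightarrow>
      ((\<lambda>y. h (\<nu> y) * poly (q k) (\<nu> y) * poly (q l) (\<nu> y) * w y) has_sum F k l) UNIV"
    and FF: "\<And>k l. k < n \<Longrightarrow> l < n \<Longrightarrow>
      ((\<lambda>y. (h (\<nu> y))\<^sup>2 * poly (q k) (\<nu> y) * poly (q l) (\<nu> y) * w y) has_sum FF k l) UNIV"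
  shows "(\<integral>\<^sup>+\<omega>. ennreal ((linear_statistic n x (h \<circ> \<mu>_of \<nu> n) \<omega> - (\<Sum>k=0..<n. F k k))\<^sup>2) \<partial>M)
    = ennreal ((\<Sum>k=0..<n. FF k k) - (\<Sum>k=0..<n. \<Sum>l=0..<n. F k l * F l k))"
proof -
  interpret prob_space M by fact
  define Z where "Z = PiE {0..<n} (\<lambda>_. UNIV :: int set)"
  define W where "W = (\<lambda>z. (det (mat n n (\<lambda>(i, j). poly (q j) (\<nu> (z i)))))\<^sup>2 * (\<Prod>i=0..<n. w (z i)))"
  define T where "T = (\<Sum>k=0..<n. F k k)"
  define V where "V = (\<Sum>k=0..<n. FF k k) - (\<Sum>k=0..<n. \<Sum>l=0..<n. F k l * F l k)"
  define X where "X z = (\<Sum>i=0..<n. h (\<nu> (z i)))" for z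
  have mom1: "(W has_sum fact n) Z"
    unfolding W_def Z_def by (rule det_ensemble_moments(1)[OF orth F FF])
  have mom2: "((\<lambda>z. (X z - T)\<^sup>2 * W z) has_sum fact n * V) Z"
    unfolding W_def Z_def X_def T_def V_def by (rule det_ensemble_moments(2)[OF orth F FF])
  \<comment> \<open>The integer tuple \<open>Y\<close> encodes the lattice points;
    \<open>restrict\<close> makes its values elements of the index set \<open>Z\<close> of the
    sums.\<close>
  define Y where "Y \<omega> = restrict (\<lambda>i. lattice_int n (x (Suc i) \<omega>)) {0..<n}" for \<omega>
  note ope = assms(2)[unfolded orthogonal_polynomial_ensemble_def]
  have xm: "x j \<in> borel_measurable M" if "j \<in> {1..n}" for j
    using ope that by simp
  have xl: "x j \<omega> \<in> Defs.lattice n" if "j \<in> {1..n}" "\<omega> \<in> space M" for j \<omega>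
    using ope that by simp
  obtain c where c: "\<forall>y. (\<forall>j \<in> {1..n}. y j \<in> Defs.lattice n) \<longrightarrow>
      measure M {\<omega> \<in> space M. \<forall>j \<in> {1..n}. x j \<omega> = y j} = c * ensemble_weight \<nu> w n y"
    using ope[THEN conjunct2] by (elim exE) (rule that)
  have x_iff: "x j \<omega> = of_int k / real n \<longleftrightarrow> lattice_int n (x j \<omega>) = k"
    if "j \<in> {1..n}" "\<omega> \<in> space M" for j \<omega> k
    using xl[OF that] lattice_int_of_int[OF \<open>n \<ge> 1\<close>] by (auto simp: Defs.lattice_def)
  have Y_eq: "{\<omega> \<in> space M. Y \<omega> = z} = {\<omega> \<in> space M. \<forall>j \<in> {1..n}. x j \<omega> = of_int (z (j - 1)) / real n}"
    if "z \<in> Z" for z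
  proof -
    have "Y \<omega> = z \<longleftrightarrow> (\<forall>j \<in> {1..n}. x j \<omega> = of_int (z (j - 1)) / real n)" if \<omega>: "\<omega> \<in> space M" for \<omega>
    proof -
      have "Y \<omega> = z \<longleftrightarrow> (\<forall>i<n. lattice_int n (x (Suc i) \<omega>) = z i)"
        using \<open>z \<in> Z\<close> by (auto simp: Y_def Z_def fun_eq_iff restrict_def PiE_def extensional_def)
      also have "\<dots> \<longleftrightarrow> (\<forall>i<n. x (Suc i) \<omega> = of_int (z i) / real n)"
        using x_iff[OF _ \<omega>] by simp
      also have "\<dots> \<longleftrightarrow> (\<forall>j \<in> {1..n}. x j \<omega> = of_int (z (j - 1)) / real n)"
      proof
        assume *: "\<forall>i<n. x (Suc i) \<omega> = of_int (z i) / real n"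
        show "\<forall>j \<in> {1..n}. x j \<omega> = of_int (z (j - 1)) / real n"
        proof
          fix j assume "j \<in> {1..n}"
          then show "x j \<omega> = of_int (z (j - 1)) / real n"
            using *[rule_format, of "j - 1"] by auto
        qed
      next
        assume *: "\<forall>j \<in> {1..n}. x j \<omega> = of_int (z (j - 1)) / real n"
        show "\<forall>i<n. x (Suc i) \<omega> = of_int (z i) / real n"
        proof (intro allI impI)
          fix i assume "i < n"
          then show "x (Suc i) \<omega> = of_int (z i) / real n"
            using *[rule_format, of "Suc i"] by auto
        qed
      qed
      finally show ?thesis .
    qed
    then show ?thesis by blast
  qed
  have Y_meas: "{\<omega> \<in> space M. Y \<omega> = z} \<in> sets M" if "z \<in> Z" for z
    unfolding Y_eq[OF that] using xm \<open>n \<ge> 1\<close> by (intro sets.sets_Collect_finite_All') auto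
  \<comment> \<open>The unknown proportionality constant absorbs the leading coefficients.\<close>
  define C where "C = c / (\<Prod>i<n. lead_coeff (q i))\<^sup>2"
  have prob: "measure M {\<omega> \<in> space M. Y \<omega> = z} = C * W z" if "z \<in> Z" for z
  proof -
    define L where "L = (\<Prod>i<n. lead_coeff (q i))"
    have "L > 0"
      unfolding L_def using lc by (intro prod_pos) simp
    moreover have "L\<^sup>2 * ensemble_weight \<nu> w n (\<lambda>j. of_int (z (j - 1)) / real n) = W z"
      using ensemble_weight_eq_det[of n q \<nu> w z] deg \<open>n \<ge> 1\<close> unfolding L_def W_def by blast
    ultimately have "c * ensemble_weight \<nu> w n (\<lambda>j. of_int (z (j - 1)) / real n) = C * W z"
      unfolding C_def L_def[symmetric] by (auto simp: field_simps)
    then show ?thesis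
      unfolding Y_eq[OF that] by (subst c[rule_format]) (auto simp: Defs.lattice_def)
  qed
  have Y_in: "Y \<omega> \<in> Z" for \<omega>
    by (simp add: Y_def Z_def)
  have "countable Z"
    unfolding Z_def by (intro countable_PiE) auto
  have sum_to: "((\<lambda>z. g z * measure M {\<omega> \<in> space M. Y \<omega> = z}) has_sum C * S) Z"
    if "((\<lambda>z. g z * W z) has_sum S) Z" for g S
  proof -
    have "((\<lambda>z. C * (g z * W z)) has_sum C * S) Z"
      by (intro has_sum_cmult_right that)
    then show ?thesis
      by (rule has_sum_cong[THEN iffD1, rotated]) (simp add: prob)
  qed
  \<comment> \<open>Total mass one, compared with the sum \<open>fact n\<close> of \<open>W\<close>,
    determines the constant.\<close>
  have "(\<integral>\<^sup>+\<omega>. ennreal 1 \<partial>M) = ennreal (C * fact n)"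
    using sum_to[of "\<lambda>_. 1" "fact n"] mom1 Y_in Y_meas \<open>countable Z\<close>
    by (intro nn_integral_discrete[where g = "\<lambda>_. 1" and Y = Y and S = Z]) (auto intro: finite_measure_axioms)
  then have C: "C * fact n = 1"
    by (simp add: emeasure_space_1)
  have "(\<integral>\<^sup>+\<omega>. ennreal ((X (Y \<omega>) - T)\<^sup>2) \<partial>M) = ennreal (C * (fact n * V))"
    using sum_to[OF mom2] Y_in Y_meas \<open>countable Z\<close>
    by (intro nn_integral_discrete[where g = "\<lambda>z. (X z - T)\<^sup>2" and Y = Y and S = Z])
      (auto intro: finite_measure_axioms)
  also have "C * (fact n * V) = V"
    using C by (simp add: mult.assoc[symmetric])
  finally have "(\<integral>\<^sup>+\<omega>. ennreal ((X (Y \<omega>) - T)\<^sup>2) \<partial>M) = ennreal V" .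
  moreover have "X (Y \<omega>) = linear_statistic n x (h \<circ> \<mu>_of \<nu> n) \<omega>" for \<omega>
    unfolding X_def linear_statistic_def Y_def
    by (rule sum.reindex_bij_witness[of _ "\<lambda>j. j - 1" Suc]) (auto simp: \<mu>_of_def)
  ultimately show ?thesis
    by (simp add: T_def V_def)
qed

subsection \<open>Powers of Jacobi matrices\<close>

text \<open>Entry \<open>(k, l)\<close> of the \<open>d\<close>-th power of the Jacobi matrix with
  diagonal \<beta> and off-diagonal \<alpha>. Multiplying from the right by a tridiagonal matrix
  turns the infinite sum over the inner index into the three neighbours of \<open>l\<close>.\<close>

fun jacobi_power :: "(nat \<Rightarrow> real) \<Rightarrow> (nat \<Rightarrow> real) \<Rightarrow> nat \<Rightarrow> nat \<Rightarrow> nat \<Rightarrow> real" where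
  "jacobi_power \<alpha> \<beta> 0 k l = of_bool (k = l)"
| "jacobi_power \<alpha> \<beta> (Suc d) k l =
     (if l = 0 then 0 else \<alpha> (l - 1) * jacobi_power \<alpha> \<beta> d k (l - 1)) +
     \<beta> l * jacobi_power \<alpha> \<beta> d k l + \<alpha> l * jacobi_power \<alpha> \<beta> d k (Suc l)"

lemma jacobi_power_eq_0: "k + d < l \<Longrightarrow> jacobi_power \<alpha> \<beta> d k l = 0"
  by (induction d arbitrary: l) auto

text \<open>Each multiplication by \<open>x\<close> raises the largest index by one, so only the
  relations below \<open>k + d\<close> are called for. A weight of finite support can provide no
  more than finitely many.\<close>

lemma jacobi_power_expansion:
  fixes r :: "nat \<Rightarrow> real"
  assumes "\<And>j. j < k + d \<Longrightarrow> x * r j = \<alpha> j * r (Suc j) + \<beta> j * r j + (if j = 0 then 0 else \<alpha> (j - 1) * r (j - 1))"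
  shows "x ^ d * r k = (\<Sum>l\<le>k + d. jacobi_power \<alpha> \<beta> d k l * r l)"
  using assms
proof (induction d)
  case 0
  have "(\<Sum>l\<le>k. of_bool (k = l) * r l) = (\<Sum>l\<le>k. if l = k then r l else 0)"
    by (intro sum.cong) auto
  then show ?case by simp
next
  case (Suc d)
  let ?c = "jacobi_power \<alpha> \<beta> d k" and ?N = "k + d"
  \<comment> \<open>The two vanishing entries just beyond the band allow the three shifted sums to
    be brought to the common range \<open>l \<le> Suc ?N\<close>.\<close>
  have z: "?c (Suc ?N) = 0" "?c (Suc (Suc ?N)) = 0"
    by (auto intro: jacobi_power_eq_0)
  have "x ^ Suc d * r k = (\<Sum>l\<le>?N. ?c l * (x * r l))"
  proof -
    have "x ^ Suc d * r k = x * (x ^ d * r k)" by simp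
    also have "x ^ d * r k = (\<Sum>l\<le>?N. ?c l * r l)" using Suc by simp
    finally show ?thesis by (simp add: sum_distrib_left mult.left_commute)
  qed
  also have "\<dots> = (\<Sum>l\<le>?N. ?c l * (\<alpha> l * r (Suc l))) + (\<Sum>l\<le>?N. ?c l * (\<beta> l * r l)) +
      (\<Sum>l\<le>?N. ?c l * (if l = 0 then 0 else \<alpha> (l - 1) * r (l - 1)))"
    using Suc.prems by (simp add: distrib_left sum.distrib)
  also have "(\<Sum>l\<le>?N. ?c l * (\<alpha> l * r (Suc l))) =
      (\<Sum>l\<le>Suc ?N. (if l = 0 then 0 else \<alpha> (l - 1) * ?c (l - 1)) * r l)"
    by (subst sum.atMost_Suc_shift) (simp add: mult_ac)
  also have "(\<Sum>l\<le>?N. ?c l * (\<beta> l * r l)) = (\<Sum>l\<le>Suc ?N. \<beta> l * ?c l * r l)"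
    by (simp add: z mult_ac)
  also have "(\<Sum>l\<le>?N. ?c l * (if l = 0 then 0 else \<alpha> (l - 1) * r (l - 1))) =
      (\<Sum>l\<le>Suc (Suc ?N). ?c l * (if l = 0 then 0 else \<alpha> (l - 1) * r (l - 1)))"
    by (simp add: z)
  also have "\<dots> = (\<Sum>l\<le>Suc ?N. \<alpha> l * ?c (Suc l) * r l)"
    by (subst sum.atMost_Suc_shift) (simp add: mult_ac)
  finally show ?case
    by (simp add: sum.distrib[symmetric] distrib_right add.assoc)
qed

text \<open>Each step of the recursion adds three terms, each at most \<open>C\<close> times the
  previous bound.\<close>

lemma jacobi_power_bound:
  assumes "\<And>j. j \<le> k + d \<Longrightarrow> \<bar>\<alpha> j\<bar> \<le> C" "\<And>j. j \<le> k + d \<Longrightarrow> \<bar>\<beta> j\<bar> \<le> C"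
  shows "\<bar>jacobi_power \<alpha> \<beta> d k l\<bar> \<le> (3 * C) ^ d"
  using assms
proof (induction d arbitrary: l)
  case 0
  show ?case by simp
next
  case (Suc d)
  have C: "0 \<le> C" using Suc.prems(1)[of 0] by simp
  have IH: "\<bar>jacobi_power \<alpha> \<beta> d k l\<bar> \<le> (3 * C) ^ d" for l
    using Suc by simp
  show ?case
  proof (cases "l \<le> k + Suc d")
    case True
    have m: "\<bar>y * jacobi_power \<alpha> \<beta> d k l'\<bar> \<le> C * (3 * C) ^ d" if "\<bar>y\<bar> \<le> C" for y l'
      using that IH[of l'] C by (simp add: abs_mult mult_mono)
    have "\<bar>if l = 0 then 0 else \<alpha> (l - 1) * jacobi_power \<alpha> \<beta> d k (l - 1)\<bar> \<le> C * (3 * C) ^ d"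
      using m[of "\<alpha> (l - 1)" "l - 1"] Suc.prems(1)[of "l - 1"] True C by simp
    moreover have "\<bar>\<beta> l * jacobi_power \<alpha> \<beta> d k l\<bar> \<le> C * (3 * C) ^ d"
      using m Suc.prems(2)[of l] True by simp
    moreover have "\<bar>\<alpha> l * jacobi_power \<alpha> \<beta> d k (Suc l)\<bar> \<le> C * (3 * C) ^ d"
      using m Suc.prems(1)[of l] True by simp
    ultimately show ?thesis by simp
  next
    case False
    \<comment> \<open>Here the coefficients may lie outside the range where they are bounded, but
      the entry is beyond the band.\<close>
    then have "jacobi_power \<alpha> \<beta> (Suc d) k l = 0"
      by (intro jacobi_power_eq_0) simp
    then show ?thesis using C by simp
  qed
qed

definition poly_jacobi :: "real poly \<Rightarrow> (nat \<Rightarrow> real) \<Rightarrow> (nat \<Rightarrow> real) \<Rightarrow> nat \<Rightarrow> nat \<Rightarrow> real" where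
  "poly_jacobi p \<alpha> \<beta> k l = (\<Sum>d\<le>degree p. Polynomial.coeff p d * jacobi_power \<alpha> \<beta> d k l)"

lemma poly_jacobi_eq_0: "k + degree p < l \<Longrightarrow> poly_jacobi p \<alpha> \<beta> k l = 0"
  by (simp add: poly_jacobi_def jacobi_power_eq_0)

lemma poly_jacobi_expansion:
  fixes r :: "nat \<Rightarrow> real"
  assumes "\<And>j. j < k + degree p \<Longrightarrow>
      x * r j = \<alpha> j * r (Suc j) + \<beta> j * r j + (if j = 0 then 0 else \<alpha> (j - 1) * r (j - 1))"
    and "k + degree p \<le> N"
  shows "poly p x * r k = (\<Sum>l\<le>N. poly_jacobi p \<alpha> \<beta> k l * r l)"
proof -
  have "x ^ d * r k = (\<Sum>l\<le>N. jacobi_power \<alpha> \<beta> d k l * r l)" if "d \<le> degree p" for d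
  proof -
    have "x ^ d * r k = (\<Sum>l\<le>k + d. jacobi_power \<alpha> \<beta> d k l * r l)"
      using that assms(1) by (intro jacobi_power_expansion) auto
    also have "\<dots> = (\<Sum>l\<le>N. jacobi_power \<alpha> \<beta> d k l * r l)"
      using that assms(2) by (intro sum.mono_neutral_left) (auto simp: jacobi_power_eq_0)
    finally show ?thesis .
  qed
  then have "poly p x * r k = (\<Sum>d\<le>degree p. Polynomial.coeff p d * (\<Sum>l\<le>N. jacobi_power \<alpha> \<beta> d k l * r l))"
    by (simp add: poly_altdef sum_distrib_right mult.assoc)
  also have "\<dots> = (\<Sum>l\<le>N. poly_jacobi p \<alpha> \<beta> k l * r l)"
    unfolding poly_jacobi_def sum_distrib_left sum_distrib_right
    by (subst sum.swap) (simp add: mult.assoc)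
  finally show ?thesis .
qed

lemma poly_jacobi_bound:
  assumes "\<And>j. j \<le> k + degree p \<Longrightarrow> \<bar>\<alpha> j\<bar> \<le> C" "\<And>j. j \<le> k + degree p \<Longrightarrow> \<bar>\<beta> j\<bar> \<le> C"
  shows "\<bar>poly_jacobi p \<alpha> \<beta> k l\<bar> \<le> (\<Sum>d\<le>degree p. \<bar>Polynomial.coeff p d\<bar> * (3 * C) ^ d)"
  unfolding poly_jacobi_def
proof (intro order.trans[OF sum_abs] sum_mono)
  fix d assume "d \<in> {..degree p}"
  then have "\<bar>jacobi_power \<alpha> \<beta> d k l\<bar> \<le> (3 * C) ^ d"
    using assms by (intro jacobi_power_bound) auto
  then show "\<bar>Polynomial.coeff p d * jacobi_power \<alpha> \<beta> d k l\<bar> \<le> \<bar>Polynomial.coeff p d\<bar> * (3 * C) ^ d"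
    by (simp only: abs_mult mult_left_mono abs_ge_zero)
qed

section \<open>The linear statistic in terms of the Jacobi matrix\<close>

lemma orth_index_mono: "orth_index w l \<Longrightarrow> k \<le> l \<Longrightarrow> orth_index w k"
  by (auto simp: orth_index_def)

text \<open>The right-hand side involves only the corner of the Jacobi matrix near the index \<open>n\<close>,
  which is why the variance stays bounded.\<close>

lemma linear_statistic_variance:
  assumes "prob_space M" "orthogonal_polynomial_ensemble M \<nu> w n x" "n \<ge> 1"
    and on: "orthonormal_polys \<nu> w P" and rc: "recurrence_coeffs \<nu> w P \<alpha> \<beta>"
    and idx: "recurrence_index w (n + degree p)"
  defines "F \<equiv> poly_jacobi p \<alpha> \<beta>"
  shows "(\<integral>\<^sup>+\<omega>. ennreal ((linear_statistic n x (poly p \<circ> \<mu>_of \<nu> n) \<omega> - (\<Sum>k<n. F k k))\<^sup>2) \<partial>M)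
    = ennreal (\<Sum>k<n. \<Sum>l=n..n + degree p. (F k l)\<^sup>2)"
proof -
  define N where "N = n + degree p"
  have orth: "orth_index w j" if "j \<le> Suc N" for j
    using idx that orth_index_mono by (auto simp: recurrence_index_def N_def)
  have on': "((\<lambda>y. poly (P k) (\<nu> y) * poly (P l) (\<nu> y) * w y) has_sum of_bool (k = l)) UNIV"
    if "k \<le> N" "l \<le> N" for k l
    using on orth[of k] orth[of l] that by (auto simp: orthonormal_polys_def of_bool_def)
  have expand: "poly p (\<nu> y) * poly (P k) (\<nu> y) = (\<Sum>m\<le>N. F k m * poly (P m) (\<nu> y))" if "k < n" for k y
    unfolding F_def
  proof (rule poly_jacobi_expansion)
    fix j assume "j < k + degree p"
    then have "recurrence_index w j"
      using that orth[of "Suc j"] by (simp add: recurrence_index_def N_def)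
    then show "\<nu> y * poly (P j) (\<nu> y) = \<alpha> j * poly (P (Suc j)) (\<nu> y) + \<beta> j * poly (P j) (\<nu> y) +
        (if j = 0 then 0 else \<alpha> (j - 1) * poly (P (j - 1)) (\<nu> y))"
      using rc by (simp add: recurrence_coeffs_def)
  qed (use that in \<open>simp add: N_def\<close>)
  have S1: "((\<lambda>y. poly p (\<nu> y) * poly (P k) (\<nu> y) * poly (P l) (\<nu> y) * w y) has_sum F k l) UNIV"
    if "k < n" "l < n" for k l
  proof -
    have "((\<lambda>y. \<Sum>m\<le>N. F k m * (poly (P m) (\<nu> y) * poly (P l) (\<nu> y) * w y)) has_sum
        (\<Sum>m\<le>N. F k m * of_bool (m = l))) UNIV"
      using that by (intro has_sum_sum has_sum_cmult_right on') (auto simp: N_def)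
    moreover have "(\<Sum>m\<le>N. F k m * of_bool (m = l)) = F k l"
      using that by (simp add: N_def of_bool_def if_distrib cong: if_cong)
    ultimately show ?thesis
      by (simp add: expand[OF that(1)] sum_distrib_right mult.assoc)
  qed
  \<comment> \<open>Parseval: one factor \<open>p\<close> goes to \<open>P k\<close> and the other
    to \<open>P l\<close>, so the matrix elements of the square of \<open>p\<close> come from
    \<open>F\<close> without expanding that square.\<close>
  have S2: "((\<lambda>y. (poly p (\<nu> y))\<^sup>2 * poly (P k) (\<nu> y) * poly (P l) (\<nu> y) * w y) has_sum
      (\<Sum>m\<le>N. F k m * F l m)) UNIV"
    if "k < n" "l < n" for k l
  proof -
    have "((\<lambda>y. \<Sum>m\<le>N. \<Sum>m'\<le>N. F k m * F l m' * (poly (P m) (\<nu> y) * poly (P m') (\<nu> y) * w y)) has_sum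
        (\<Sum>m\<le>N. \<Sum>m'\<le>N. F k m * F l m' * of_bool (m = m'))) UNIV"
      using that by (intro has_sum_sum has_sum_cmult_right on') auto
    moreover have "(\<Sum>m'\<le>N. F k m * F l m' * of_bool (m = m')) = F k m * F l m" if "m \<le> N" for m
      using that by (simp add: of_bool_def if_distrib cong: if_cong)
    moreover have "(\<Sum>m\<le>N. \<Sum>m'\<le>N. F k m * F l m' * (poly (P m) (\<nu> y) * poly (P m') (\<nu> y) * w y)) =
        (poly p (\<nu> y))\<^sup>2 * poly (P k) (\<nu> y) * poly (P l) (\<nu> y) * w y" for y
    proof -
      have "(poly p (\<nu> y))\<^sup>2 * poly (P k) (\<nu> y) * poly (P l) (\<nu> y) * w y =
          (poly p (\<nu> y) * poly (P k) (\<nu> y)) * (poly p (\<nu> y) * poly (P l) (\<nu> y)) * w y"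
        by (simp add: power2_eq_square mult_ac)
      also have "\<dots> = (\<Sum>m\<le>N. \<Sum>m'\<le>N. F k m * poly (P m) (\<nu> y) * (F l m' * poly (P m') (\<nu> y)) * w y)"
        unfolding expand[OF that(1)] expand[OF that(2)] sum_product by (simp only: sum_distrib_right)
      finally show ?thesis by (simp add: mult_ac)
    qed
    ultimately show ?thesis by simp
  qed
  \<comment> \<open>The recursion, which works on columns only, does not show this symmetry. It
    follows because both entries are values of the same sum; it turns \<open>F k l * F l k\<close>
    into a square.\<close>
  have sym: "F k l = F l k" if "k < n" "l < n" for k l
    by (rule has_sum_unique[OF S1[OF that]])
      (use S1[OF that(2,1)] in \<open>simp add: mult_ac\<close>)
  have "(\<integral>\<^sup>+\<omega>. ennreal ((linear_statistic n x (poly p \<circ> \<mu>_of \<nu> n) \<omega> - (\<Sum>k=0..<n. F k k))\<^sup>2) \<partial>M)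
    = ennreal ((\<Sum>k=0..<n. \<Sum>m\<le>N. F k m * F k m) - (\<Sum>k=0..<n. \<Sum>l=0..<n. F k l * F l k))"
  proof (rule linear_statistic_second_moment[OF assms(1-3), where q = P
        and FF = "\<lambda>k l. \<Sum>m\<le>N. F k m * F l m"])
    show "degree (P k) = k" "0 < lead_coeff (P k)" if "k < n" for k
      using on orth[of k] that by (auto simp: orthonormal_polys_def N_def)
    show "((\<lambda>y. poly (P k) (\<nu> y) * poly (P l) (\<nu> y) * w y) has_sum of_bool (k = l)) UNIV"
      if "k < n" "l < n" for k l
      using that by (intro on') (auto simp: N_def)
  qed (fact S1 S2)+
  also have "(\<Sum>k=0..<n. \<Sum>m\<le>N. F k m * F k m) - (\<Sum>k=0..<n. \<Sum>l=0..<n. F k l * F l k) =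
      (\<Sum>k=0..<n. (\<Sum>m\<le>N. F k m * F k m) - (\<Sum>l=0..<n. F k l * F l k))"
    by (simp add: sum_subtractf)
  also have "\<dots> = (\<Sum>k=0..<n. \<Sum>l=n..N. (F k l)\<^sup>2)"
  proof (rule sum.cong[OF refl])
    fix k assume "k \<in> {0..<n}"
    then have "(\<Sum>l=0..<n. F k l * F l k) = (\<Sum>l=0..<n. F k l * F k l)"
      by (intro sum.cong) (auto simp: sym[of _ k])
    \<comment> \<open>The block of columns below \<open>n\<close> cancels, leaving only entries that
      lead out of the first \<open>n\<close> indices.\<close>
    moreover have "(\<Sum>m\<le>N. F k m * F k m) = (\<Sum>m=0..<n. F k m * F k m) + (\<Sum>m=n..N. F k m * F k m)"
    proof -
      have "{..N} = {0..<n} \<union> {n..N}" by (auto simp: N_def)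
      then show ?thesis by (simp only:) (rule sum.union_disjoint, auto)
    qed
    ultimately show "(\<Sum>m\<le>N. F k m * F k m) - (\<Sum>l=0..<n. F k l * F l k) = (\<Sum>l=n..N. (F k l)\<^sup>2)"
      by (simp add: power2_eq_square)
  qed
  finally show ?thesis
    by (simp only: N_def atLeast0LessThan)
qed

text \<open>A nonzero term has \<open>k < n \<le> l \<le> k + D\<close>, so at most \<open>D\<close>
  rows and \<open>D + 1\<close> columns take part, however large \<open>n\<close> is.\<close>

lemma corner_sum_bound:
  fixes F :: "nat \<Rightarrow> nat \<Rightarrow> real"
  assumes "\<And>k l. k < n \<Longrightarrow> \<bar>F k l\<bar> \<le> B" "\<And>k l. k + D < l \<Longrightarrow> F k l = 0"
  shows "(\<Sum>k<n. \<Sum>l=n..n + D. (F k l)\<^sup>2) \<le> real (D * (D + 1)) * B\<^sup>2"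
proof -
  have "(\<Sum>k<n. \<Sum>l=n..n + D. (F k l)\<^sup>2) = (\<Sum>k=n - D..<n. \<Sum>l=n..n + D. (F k l)\<^sup>2)"
    using assms(2) by (intro sum.mono_neutral_right) (auto intro!: sum.neutral)
  also have "\<dots> \<le> (\<Sum>k=n - D..<n. \<Sum>l=n..n + D. B\<^sup>2)"
  proof (intro sum_mono)
    fix k l assume "k \<in> {n - D..<n}"
    then show "(F k l)\<^sup>2 \<le> B\<^sup>2"
      using power_mono[OF assms(1) abs_ge_zero, of k l 2] by simp
  qed
  also have "\<dots> = real (card {n - D..<n}) * (real (D + 1) * B\<^sup>2)"
    by simp
  also have "\<dots> = real (card {n - D..<n} * (D + 1)) * B\<^sup>2"
    by (simp only: of_nat_mult mult.assoc)
  also have "\<dots> \<le> real (D * (D + 1)) * B\<^sup>2"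
    by (intro mult_right_mono of_nat_mono mult_le_mono) auto
  finally show ?thesis .
qed

subsection \<open>Averages over the arcsine law\<close>

text \<open>The \<open>i\<close>-th Fourier coefficient of the \<open>d\<close>-th power of the
  symbol \<open>b + 2 * a * cos \<theta>\<close>, that is, the entry at distance \<open>i\<close>
  from the diagonal in the \<open>d\<close>-th power of the doubly infinite Toeplitz matrix. The
  symbol is even, so cosines over half a period suffice.\<close>

definition arcsine_moment :: "real \<Rightarrow> real \<Rightarrow> nat \<Rightarrow> int \<Rightarrow> real" where
  "arcsine_moment a b d i =
     1 / pi * (LBINT \<theta>:{0..pi}. (b + 2 * a * cos \<theta>) ^ d * cos (of_int i * \<theta>))"

lemma arcsine_moment_0: "arcsine_moment a b 0 i = of_bool (i = 0)"
proof (cases "i = 0")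
  case True
  then show ?thesis by (simp add: arcsine_moment_def set_lebesgue_integral_def)
next
  case False
  have "(LBINT \<theta>:{0..pi}. cos (of_int i * \<theta>)) = sin (of_int i * pi) / of_int i - sin (of_int i * 0) / of_int i"
    using False unfolding set_lebesgue_integral_def
    by (subst integral_FTC_atLeastAtMost[where F = "\<lambda>\<theta>. sin (of_int i * \<theta>) / of_int i", symmetric])
      (auto intro!: derivative_eq_intros continuous_intros has_vector_derivative_at_within
        simp: has_real_derivative_iff_has_vector_derivative[symmetric])
  then show ?thesis
    using False sin_integer_2pi by (simp add: arcsine_moment_def sin_zero_iff_int2)
qed

text \<open>The product formula for \<open>2 * cos \<theta> * cos (i * \<theta>)\<close> makes
  multiplication by the symbol act on frequencies exactly as \<open>jacobi_power\<close> acts on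
  columns, with constant coefficients and no boundary.\<close>

lemma arcsine_moment_Suc:
  "arcsine_moment a b (Suc d) i =
     a * arcsine_moment a b d (i - 1) + b * arcsine_moment a b d i + a * arcsine_moment a b d (i + 1)"
proof -
  let ?I = "\<lambda>i. LBINT \<theta>:{0..pi}. (b + 2 * a * cos \<theta>) ^ d * cos (of_int i * \<theta>)"
  have int: "set_integrable lborel {0..pi} (\<lambda>\<theta>. (b + 2 * a * cos \<theta>) ^ d * cos (of_int i * \<theta>))" for i
    by (intro borel_integrable_atLeastAtMost' continuous_intros)
  have cos: "2 * cos \<theta> * cos (of_int i * \<theta>) = cos (of_int (i - 1) * \<theta>) + cos (of_int (i + 1) * \<theta>)" for \<theta> :: real
    by (simp add: algebra_simps cos_add cos_diff)
  have "(b + 2 * a * cos \<theta>) ^ Suc d * cos (of_int i * \<theta>) =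
      (a * ((b + 2 * a * cos \<theta>) ^ d * cos (of_int (i - 1) * \<theta>)) +
      b * ((b + 2 * a * cos \<theta>) ^ d * cos (of_int i * \<theta>))) +
      a * ((b + 2 * a * cos \<theta>) ^ d * cos (of_int (i + 1) * \<theta>))" for \<theta>
  proof -
    have "(b + 2 * a * cos \<theta>) ^ Suc d * cos (of_int i * \<theta>) =
      (b + 2 * a * cos \<theta>) ^ d * (b * cos (of_int i * \<theta>) + a * (2 * cos \<theta> * cos (of_int i * \<theta>)))"
      by (simp add: algebra_simps)
    then show ?thesis unfolding cos by (simp only: distrib_left mult_ac add_ac)
  qed
  then have "(LBINT \<theta>:{0..pi}. (b + 2 * a * cos \<theta>) ^ Suc d * cos (of_int i * \<theta>)) =
      a * ?I (i - 1) + b * ?I i + a * ?I (i + 1)"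
    using int[of "i - 1"] int[of i] int[of "i + 1"] by (simp only: set_integral_add set_integrable_mult_right set_integral_mult_right)
  then show ?thesis
    by (simp add: arcsine_moment_def distrib_left add_divide_distrib)
qed

text \<open>For uniform angle, \<open>b + 2 * a * cos \<theta>\<close> follows the arcsine law on
  the interval from \<open>b - 2 * a\<close> to \<open>b + 2 * a\<close>. Unlike the density, this
  form still makes sense at \<open>a = 0\<close>, where it is the point mass at \<open>b\<close>; it
  thus unites both terms of the limit.\<close>

definition arcsine_mean :: "real poly \<Rightarrow> real \<Rightarrow> real \<Rightarrow> real" where
  "arcsine_mean p a b = 1 / pi * (LBINT \<theta>:{0..pi}. poly p (b + 2 * a * cos \<theta>))"

lemma arcsine_mean_eq_moments:
  "arcsine_mean p a b = (\<Sum>d\<le>degree p. Polynomial.coeff p d * arcsine_moment a b d 0)"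
proof -
  have "(LBINT \<theta>:{0..pi}. poly p (b + 2 * a * cos \<theta>)) =
      (LINT \<theta>|lborel. (\<Sum>d\<le>degree p. indicator {0..pi} \<theta> *\<^sub>R (Polynomial.coeff p d * (b + 2 * a * cos \<theta>) ^ d)))"
    by (simp add: set_lebesgue_integral_def poly_altdef sum_distrib_left)
  also have "\<dots> = (\<Sum>d\<le>degree p. LBINT \<theta>:{0..pi}. Polynomial.coeff p d * (b + 2 * a * cos \<theta>) ^ d)"
    unfolding set_lebesgue_integral_def
  proof (rule Bochner_Integration.integral_sum)
    fix d
    have "set_integrable lborel {0..pi} (\<lambda>\<theta>. Polynomial.coeff p d * (b + 2 * a * cos \<theta>) ^ d)"
      by (intro borel_integrable_atLeastAtMost' continuous_intros)
    then show "integrable lborel (\<lambda>\<theta>. indicator {0..pi} \<theta> *\<^sub>R (Polynomial.coeff p d * (b + 2 * a * cos \<theta>) ^ d))"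
      by (simp add: set_integrable_def)
  qed
  finally show ?thesis
    by (simp add: arcsine_mean_def arcsine_moment_def sum_distrib_left mult_ac)
qed

lemma arcsine_mean_0: "arcsine_mean p 0 b = poly p b"
  by (simp add: arcsine_mean_def set_lebesgue_integral_def)

lemma arcsine_mean_density:
  assumes "a > 0"
  shows "(LBINT t:{b - 2 * a..b + 2 * a}. poly p t / sqrt (4 * a\<^sup>2 - (t - b)\<^sup>2)) = pi * arcsine_mean p a b"
proof -
  define f where "f t = poly p t / sqrt (4 * a\<^sup>2 - (t - b)\<^sup>2)" for t
  \<comment> \<open>The minus sign makes the substitution increasing on \<open>{0..pi}\<close>, as
    the substitution rules require.\<close>
  define g where "g \<theta> = b - 2 * a * cos \<theta>" for \<theta>
  define g' where "g' \<theta> = 2 * a * sin \<theta>" for \<theta>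
  have ends: "g 0 = b - 2 * a" "g pi = b + 2 * a"
    by (simp_all add: g_def)
  have deriv: "(g has_real_derivative g' \<theta>) (at \<theta>)" for \<theta>
    unfolding g_def g'_def by (auto intro!: derivative_eq_intros)
  have cont: "continuous_on {0..pi} g'"
    unfolding g'_def by (intro continuous_intros)
  have nonneg: "0 \<le> g' \<theta>" if "\<theta> \<in> {0..pi}" for \<theta>
    using that assms by (auto simp: g'_def sin_ge_zero)
  have [measurable]: "poly p \<in> borel_measurable borel"
    by (intro borel_measurable_continuous_onI continuous_intros)
  have fm: "f \<in> borel_measurable borel"
    unfolding f_def by measurable
  have fg: "f (g \<theta>) * g' \<theta> = poly p (g \<theta>)" if "0 < \<theta>" "\<theta> < pi" for \<theta>
  proof -
    have "sin \<theta> > 0" using that sin_gt_zero by blast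
    have "4 * a\<^sup>2 - (g \<theta> - b)\<^sup>2 = (2 * a * sin \<theta>)\<^sup>2"
      by (simp add: g_def power_mult_distrib sin_squared_eq algebra_simps)
    then have "sqrt (4 * a\<^sup>2 - (g \<theta> - b)\<^sup>2) = 2 * a * sin \<theta>"
      using assms \<open>sin \<theta> > 0\<close> by (simp add: real_sqrt_unique)
    then show ?thesis
      using assms \<open>sin \<theta> > 0\<close> by (simp add: f_def g'_def)
  qed
  have fg0: "f (g \<theta>) * g' \<theta> = 0" if "\<theta> = 0 \<or> \<theta> = pi" for \<theta>
    using that by (auto simp: g'_def)
  have ci: "integrable lborel (\<lambda>\<theta>. indicator {0..pi} \<theta> *\<^sub>R poly p (g \<theta>))"
    using borel_integrable_atLeastAtMost'[of 0 pi "\<lambda>\<theta>. poly p (g \<theta>)"]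
    by (simp add: set_integrable_def g_def continuous_intros)
  \<comment> \<open>The density is unbounded at both ends, so integrability is not automatic. The
    nonnegative substitution rule reduces it to the integrability of a continuous function on
    \<open>{0..pi}\<close>.\<close>
  have int: "set_integrable lborel {g 0..g pi} f"
    unfolding set_integrable_def
  proof (rule integrableI_bounded)
    show "(\<lambda>x. indicator {g 0..g pi} x *\<^sub>R f x) \<in> borel_measurable lborel"
      using fm by simp
    have "(\<integral>\<^sup>+x. ennreal (norm (indicator {g 0..g pi} x *\<^sub>R f x)) \<partial>lborel) =
        (\<integral>\<^sup>+x. ennreal (\<bar>f x\<bar> * indicator {g 0..g pi} x) \<partial>lborel)"
      by (intro nn_integral_cong) (simp add: indicator_def)
    also have "\<dots> = (\<integral>\<^sup>+\<theta>. ennreal (\<bar>f (g \<theta>)\<bar> * g' \<theta> * indicator {0..pi} \<theta>) \<partial>lborel)"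
      using fm by (intro nn_integral_substitution deriv cont nonneg) (auto simp: set_borel_measurable_def)
    also have "\<dots> \<le> (\<integral>\<^sup>+\<theta>. ennreal (norm (indicator {0..pi} \<theta> *\<^sub>R poly p (g \<theta>))) \<partial>lborel)"
    proof (intro nn_integral_mono ennreal_leI)
      fix \<theta>
      show "\<bar>f (g \<theta>)\<bar> * g' \<theta> * indicator {0..pi} \<theta> \<le> norm (indicator {0..pi} \<theta> *\<^sub>R poly p (g \<theta>))"
      proof (cases "\<theta> \<in> {0..pi}")
        case True
        then have "\<bar>f (g \<theta>)\<bar> * g' \<theta> = \<bar>f (g \<theta>) * g' \<theta>\<bar>"
          using nonneg by (simp add: abs_mult)
        also have "\<dots> \<le> \<bar>poly p (g \<theta>)\<bar>"
          using fg[of \<theta>] fg0[of \<theta>] True by (cases "\<theta> = 0 \<or> \<theta> = pi") auto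
        finally show ?thesis using True by simp
      qed simp
    qed
    also have "\<dots> < \<infinity>"
      using ci by (simp add: integrable_iff_bounded)
    finally show "(\<integral>\<^sup>+x. ennreal (norm (indicator {g 0..g pi} x *\<^sub>R f x)) \<partial>lborel) < \<infinity>" .
  qed
  have "(LBINT t:{b - 2 * a..b + 2 * a}. f t) = (LBINT x. f x * indicator {g 0..g pi} x)"
    by (simp add: set_lebesgue_integral_def ends mult.commute)
  also have "\<dots> = (LBINT \<theta>. f (g \<theta>) * g' \<theta> * indicator {0..pi} \<theta>)"
    by (intro integral_substitution int deriv cont nonneg) auto
  also have "\<dots> = (LBINT \<theta>. poly p (g \<theta>) * indicator {0..pi} \<theta>)"
    by (rule integral_discrete_difference[where X = "{0, pi}"]) (auto simp: fg indicator_def)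
  \<comment> \<open>The reflection of \<theta> to \<open>pi - \<theta>\<close> restores the sign of
    the cosine.\<close>
  also have "\<dots> = (LBINT \<theta>. indicator {0..pi} \<theta> * poly p (b + 2 * a * cos \<theta>))"
    by (subst lborel_integral_real_affine[of "-1" _ pi])
      (auto intro!: Bochner_Integration.integral_cong simp: g_def indicator_def)
  finally show ?thesis
    by (simp add: f_def arcsine_mean_def set_lebesgue_integral_def)
qed

text \<open>The zero set of \<open>a\<close> is closed, hence measurable, and the interval is split
  along it. Integrability of the mean is taken as a hypothesis; in the application it is a
  by-product of the dominated convergence that produces the limit.\<close>

lemma arcsine_mean_integral_split:
  fixes a b :: "real \<Rightarrow> real"
  assumes "continuous_on {0..1} a" "\<And>\<xi>. \<xi> \<in> {0..1} \<Longrightarrow> 0 \<le> a \<xi>"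
    and int: "set_integrable lborel {0..1} (\<lambda>\<xi>. arcsine_mean p (a \<xi>) (b \<xi>))"
  shows "1 / pi * (LBINT \<xi>:{0..1}.
          (if a \<xi> = 0 then 0
           else (LBINT t:{b \<xi> - 2 * a \<xi>..b \<xi> + 2 * a \<xi>}.
                   poly p t / sqrt (4 * (a \<xi>)\<^sup>2 - (t - b \<xi>)\<^sup>2)))) +
      (LBINT \<xi>:{\<xi> \<in> {0..1}. a \<xi> = 0}. poly p (b \<xi>)) =
      (LBINT \<xi>:{0..1}. arcsine_mean p (a \<xi>) (b \<xi>))"
proof -
  define Z where "Z = {\<xi> \<in> {0..1}. a \<xi> = 0}"
  define \<Phi> where "\<Phi> \<xi> = arcsine_mean p (a \<xi>) (b \<xi>)" for \<xi>
  have "closed Z"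
    unfolding Z_def using continuous_closed_preimage_constant[OF assms(1) closed_real_atLeastAtMost, of 0] by simp
  then have Z: "Z \<in> sets lborel" by simp
  have int1: "set_integrable lborel Z \<Phi>" "set_integrable lborel ({0..1} - Z) \<Phi>"
  proof -
    have "set_integrable lborel S \<Phi>" if "S \<in> sets lborel" "S \<subseteq> {0..1}" for S
      unfolding \<Phi>_def by (rule set_integrable_subset[OF int that])
    moreover have "Z \<subseteq> {0..1}" by (auto simp: Z_def)
    ultimately show "set_integrable lborel Z \<Phi>" "set_integrable lborel ({0..1} - Z) \<Phi>"
      using Z by auto
  qed
  have "(LBINT \<xi>:{0..1}. (if a \<xi> = 0 then 0
           else (LBINT t:{b \<xi> - 2 * a \<xi>..b \<xi> + 2 * a \<xi>}.
                   poly p t / sqrt (4 * (a \<xi>)\<^sup>2 - (t - b \<xi>)\<^sup>2)))) =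
        (LBINT \<xi>:{0..1} - Z. pi * \<Phi> \<xi>)"
    unfolding set_lebesgue_integral_def
  proof (rule Bochner_Integration.integral_cong[OF refl])
    fix \<xi> :: real
    show "indicator {0..1} \<xi> *\<^sub>R (if a \<xi> = 0 then 0
           else (LINT t|lborel. indicator {b \<xi> - 2 * a \<xi>..b \<xi> + 2 * a \<xi>} t *\<^sub>R
                   (poly p t / sqrt (4 * (a \<xi>)\<^sup>2 - (t - b \<xi>)\<^sup>2)))) =
        indicator ({0..1} - Z) \<xi> *\<^sub>R (pi * \<Phi> \<xi>)"
      using arcsine_mean_density[of "a \<xi>" "b \<xi>" p] assms(2)[of \<xi>]
      by (auto simp: Z_def \<Phi>_def indicator_def set_lebesgue_integral_def)
  qed
  moreover have "(LBINT \<xi>:Z. poly p (b \<xi>)) = (LBINT \<xi>:Z. \<Phi> \<xi>)"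
    unfolding set_lebesgue_integral_def
    by (rule Bochner_Integration.integral_cong) (auto simp: Z_def \<Phi>_def arcsine_mean_0 indicator_def)
  moreover have "(LBINT \<xi>:{0..1}. \<Phi> \<xi>) = (LBINT \<xi>:{0..1} - Z. \<Phi> \<xi>) + (LBINT \<xi>:Z. \<Phi> \<xi>)"
  proof -
    have "{0..1} = ({0..1} - Z) \<union> Z" by (auto simp: Z_def)
    then show ?thesis
      using set_integral_Un[of "{0..1} - Z" Z lborel \<Phi>] int1 by auto
  qed
  ultimately show ?thesis
    by (simp add: Z_def \<Phi>_def)
qed

subsection \<open>Limits\<close>

text \<open>A bounded shift of the index does not change the limit of its ratio to \<open>n\<close>,
  so all coefficients met in a fixed power have the limits \<open>a\<close> and \<open>b\<close>,
  and the recursion passes to that of the Toeplitz matrix. The offset \<open>i\<close> is general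
  because the induction step visits its neighbours.\<close>

lemma jacobi_power_limit:
  fixes \<alpha> \<beta> :: "nat \<Rightarrow> nat \<Rightarrow> real" and k :: "nat \<Rightarrow> nat"
  assumes k: "(\<lambda>n. real (k n) / real n) \<longlonglongrightarrow> \<xi>" "filterlim k at_top sequentially"
    and \<alpha>: "\<And>j. (\<lambda>n. real (j n) / real n) \<longlonglongrightarrow> \<xi> \<Longrightarrow> (\<lambda>n. \<alpha> n (j n)) \<longlonglongrightarrow> a"
    and \<beta>: "\<And>j. (\<lambda>n. real (j n) / real n) \<longlonglongrightarrow> \<xi> \<Longrightarrow> (\<lambda>n. \<beta> n (j n)) \<longlonglongrightarrow> b"
  shows "(\<lambda>n. jacobi_power (\<alpha> n) (\<beta> n) d (k n) (nat (int (k n) + i))) \<longlonglongrightarrow> arcsine_moment a b d i"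
proof (induction d arbitrary: i)
  case 0
  have "\<forall>\<^sub>F n in sequentially. k n \<ge> nat \<bar>i\<bar>"
    using k(2) by (simp add: filterlim_at_top)
  then have "\<forall>\<^sub>F n in sequentially. of_bool (i = 0) = jacobi_power (\<alpha> n) (\<beta> n) 0 (k n) (nat (int (k n) + i))"
    by eventually_elim auto
  then show ?case unfolding arcsine_moment_0
    by (rule Lim_transform_eventually[OF tendsto_const])
next
  case (Suc d)
  define l where "l n = nat (int (k n) + i)" for n
  \<comment> \<open>The extra 1 keeps the column index positive, so that the recursion takes its
    interior branch and no subtraction is truncated.\<close>
  have ev: "\<forall>\<^sub>F n in sequentially. k n \<ge> nat \<bar>i\<bar> + 1"
    using k(2) by (simp add: filterlim_at_top)
  have shift: "(\<lambda>n. real (nat (int (k n) + m)) / real n) \<longlonglongrightarrow> \<xi>" for m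
  proof -
    have "(\<lambda>n. real (k n) / real n + of_int m / real n) \<longlonglongrightarrow> \<xi> + 0"
      by (intro tendsto_add k) real_asymp
    moreover have "\<forall>\<^sub>F n in sequentially. k n \<ge> nat \<bar>m\<bar>"
      using k(2) by (simp add: filterlim_at_top)
    then have "\<forall>\<^sub>F n in sequentially. real (k n) / real n + of_int m / real n = real (nat (int (k n) + m)) / real n"
      by eventually_elim (auto simp: add_divide_distrib[symmetric] of_nat_nat)
    ultimately show ?thesis by (auto intro: Lim_transform_eventually)
  qed
  let ?c = "\<lambda>n. jacobi_power (\<alpha> n) (\<beta> n) d (k n)"
  have "(\<lambda>n. \<alpha> n (nat (int (k n) + (i - 1))) * ?c n (nat (int (k n) + (i - 1))) +
     \<beta> n (nat (int (k n) + i)) * ?c n (nat (int (k n) + i)) +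
     \<alpha> n (nat (int (k n) + i)) * ?c n (nat (int (k n) + (i + 1)))) \<longlonglongrightarrow>
     arcsine_moment a b (Suc d) i"
    unfolding arcsine_moment_Suc by (intro tendsto_intros Suc.IH \<alpha> \<beta> shift)
  moreover have "\<forall>\<^sub>F n in sequentially. 
    \<alpha> n (nat (int (k n) + (i - 1))) * ?c n (nat (int (k n) + (i - 1))) +
     \<beta> n (nat (int (k n) + i)) * ?c n (nat (int (k n) + i)) +
     \<alpha> n (nat (int (k n) + i)) * ?c n (nat (int (k n) + (i + 1))) =
    jacobi_power (\<alpha> n) (\<beta> n) (Suc d) (k n) (nat (int (k n) + i))"
    using ev
  proof eventually_elim
    case (elim n)
    then have "nat (int (k n) + (i - 1)) = nat (int (k n) + i) - 1" "nat (int (k n) + i) \<noteq> 0"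
      "nat (int (k n) + (i + 1)) = Suc (nat (int (k n) + i))"
      by auto
    then show ?case by simp
  qed
  ultimately show ?case by (rule Lim_transform_eventually)
qed

text \<open>Compactness makes the sequential hypothesis uniform. If no bound existed, indices with
  ever larger values could be chosen, and a subsequence of their ratios to \<open>n\<close> would
  converge; along it the values would have to be both convergent and unbounded.\<close>

lemma bounded_of_ray_limits:
  fixes \<gamma> :: "nat \<Rightarrow> nat \<Rightarrow> real"
  assumes lim: "\<And>\<xi> j. \<xi> \<in> {0..1} \<Longrightarrow> (\<lambda>n. real (j n) / real n) \<longlonglongrightarrow> \<xi> \<Longrightarrow> (\<lambda>n. \<gamma> n (j n)) \<longlonglongrightarrow> g \<xi>"
  shows "\<exists>C. \<forall>\<^sub>F n in sequentially. \<forall>j\<le>n + m. \<bar>\<gamma> n j\<bar> \<le> C"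
proof (rule ccontr)
  assume neg: "\<not> ?thesis"
  define Q where "Q k n \<longleftrightarrow> n \<ge> 1 \<and> (\<exists>j\<le>n + m. \<bar>\<gamma> n j\<bar> > real k)" for k n
  have Q: "\<exists>n>N. Q k n" for k N
  proof -
    have "\<not> (\<forall>\<^sub>F n in sequentially. \<forall>j\<le>n + m. \<bar>\<gamma> n j\<bar> \<le> real k)"
      using neg by blast
    then obtain n where "n \<ge> Suc N" "\<not> (\<forall>j\<le>n + m. \<bar>\<gamma> n j\<bar> \<le> real k)"
      unfolding eventually_sequentially by blast
    then show ?thesis by (intro exI[of _ n]) (auto simp: Q_def not_le)
  qed
  obtain \<rho> where \<rho>: "\<And>k. Q k (\<rho> k)" "\<And>k. \<rho> k < \<rho> (Suc k)"
    using dependent_nat_choice[of Q "\<lambda>_. (<)"] Q by metis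
  have mono: "strict_mono \<rho>" using \<rho>(2) by (simp add: strict_mono_Suc_iff)
  obtain J where J: "\<And>k. J k \<le> \<rho> k + m" "\<And>k. \<bar>\<gamma> (\<rho> k) (J k)\<bar> > real k"
    using \<rho>(1) unfolding Q_def by metis
  have pos: "\<rho> k \<ge> 1" for k using \<rho>(1) by (simp add: Q_def)
  define q where "q k = real (J k) / real (\<rho> k)" for k
  have q_le: "q k \<le> 1 + real m / real (\<rho> k)" for k
  proof -
    have "real (J k) \<le> real (\<rho> k) + real m" using J(1)[of k] by linarith
    then show ?thesis using pos[of k] by (simp add: q_def field_simps)
  qed
  have "q k \<in> {0..1 + real m}" for k
  proof -
    have "real m / real (\<rho> k) \<le> real m" using pos[of k] by (simp add: field_simps mult_le_cancel_left1)
    then show ?thesis using q_le[of k] by (auto simp: q_def)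
  qed
  then obtain \<xi> \<sigma> where \<sigma>: "strict_mono \<sigma>" "(q \<circ> \<sigma>) \<longlonglongrightarrow> \<xi>"
    using compact_imp_seq_compact[OF compact_Icc, of 0 "1 + real m"] unfolding seq_compact_def by metis
  define \<tau> where "\<tau> = \<rho> \<circ> \<sigma>"
  have \<tau>: "strict_mono \<tau>" using mono \<sigma>(1) by (simp add: \<tau>_def strict_mono_o)
  have lim_\<tau>: "(\<lambda>k. real m / real (\<tau> k)) \<longlonglongrightarrow> 0"
    using LIMSEQ_subseq_LIMSEQ[OF lim_const_over_n \<tau>] by (simp add: o_def)
  \<comment> \<open>The ratios may exceed 1, but by at most \<open>m / n\<close>, which disappears
    in the limit.\<close>
  have "\<xi> \<in> {0..1}"
  proof -
    have "0 \<le> \<xi>" by (rule LIMSEQ_le_const[OF \<sigma>(2)]) (auto simp: q_def)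
    moreover have "\<xi> \<le> 1 + 0"
      using q_le by (intro LIMSEQ_le[OF \<sigma>(2) tendsto_add[OF tendsto_const lim_\<tau>]]) (auto simp: \<tau>_def)
    ultimately show ?thesis by simp
  qed
  \<comment> \<open>The hypothesis speaks of sequences defined for every \<open>n\<close>. The gaps
    between the bad indices are filled with the standard sequence of ratio limit \<xi>.\<close>
  define j where "j n = (if n \<in> range \<tau> then J (\<sigma> (inv_into UNIV \<tau> n)) else nat \<lfloor>real n * \<xi>\<rfloor>)" for n
  have j_\<tau>: "j (\<tau> k) = J (\<sigma> k)" for k
    using strict_mono_imp_inj_on[OF \<tau>] by (simp add: j_def)
  have floor_lim: "(\<lambda>n. real (nat \<lfloor>real n * \<xi>\<rfloor>) / real n) \<longlonglongrightarrow> \<xi>"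
  proof (rule tendsto_sandwich)
    have "real n * \<xi> - 1 \<le> real (nat \<lfloor>real n * \<xi>\<rfloor>)" "real (nat \<lfloor>real n * \<xi>\<rfloor>) \<le> real n * \<xi>" for n
      using \<open>\<xi> \<in> {0..1}\<close> by (simp_all add: of_nat_nat)
    then show "\<forall>\<^sub>F n in sequentially. \<xi> - 1 / real n \<le> real (nat \<lfloor>real n * \<xi>\<rfloor>) / real n"
      "\<forall>\<^sub>F n in sequentially. real (nat \<lfloor>real n * \<xi>\<rfloor>) / real n \<le> \<xi>"
      by (auto intro!: eventually_sequentiallyI[of 1] simp: field_simps)
    show "(\<lambda>n. \<xi> - 1 / real n) \<longlonglongrightarrow> \<xi>" by real_asymp
  qed simp
  have "(\<lambda>n. real (j n) / real n) \<longlonglongrightarrow> \<xi>"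
  proof (rule LIMSEQ_I)
    fix e :: real assume "e > 0"
    obtain N where N: "\<And>n. n \<ge> N \<Longrightarrow> norm (real (nat \<lfloor>real n * \<xi>\<rfloor>) / real n - \<xi>) < e"
      using LIMSEQ_D[OF floor_lim \<open>e > 0\<close>] by blast
    obtain K where K: "\<And>k. k \<ge> K \<Longrightarrow> norm (q (\<sigma> k) - \<xi>) < e"
      using LIMSEQ_D[OF \<sigma>(2) \<open>e > 0\<close>] by auto
    have "norm (real (j n) / real n - \<xi>) < e" if n: "n \<ge> max N (\<tau> K)" for n
    proof (cases "n \<in> range \<tau>")
      case True
      then obtain k where k: "n = \<tau> k" by blast
      then have "k \<ge> K" using n strict_mono_less_eq[OF \<tau>] by simp
      then show ?thesis unfolding k j_\<tau> using K[of k] by (simp add: q_def \<tau>_def)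
    next
      case False
      then show ?thesis using N[of n] n by (simp add: j_def)
    qed
    then show "\<exists>no. \<forall>n\<ge>no. norm (real (j n) / real n - \<xi>) < e" by blast
  qed
  then have "(\<lambda>n. \<gamma> n (j n)) \<longlonglongrightarrow> g \<xi>"
    by (rule lim[OF \<open>\<xi> \<in> {0..1}\<close>])
  then have "(\<lambda>k. \<gamma> (\<tau> k) (J (\<sigma> k))) \<longlonglongrightarrow> g \<xi>"
    using LIMSEQ_subseq_LIMSEQ[OF _ \<tau>, of "\<lambda>n. \<gamma> n (j n)"] by (simp add: o_def j_\<tau>)
  then obtain B where B: "\<And>k. \<bar>\<gamma> (\<tau> k) (J (\<sigma> k))\<bar> \<le> B"
    using convergent_imp_Bseq[of "\<lambda>k. \<gamma> (\<tau> k) (J (\<sigma> k))"] unfolding Bseq_def convergent_def by auto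
  obtain k where "real k > B" using reals_Archimedean2 by blast
  moreover have "real k \<le> real (\<sigma> k)" using seq_suble[OF \<sigma>(1)] by simp
  ultimately show False
    using B[of k] J(2)[of "\<sigma> k"] by (simp add: \<tau>_def)
qed

text \<open>The average is the integral of a step function that takes the value \<open>G n k\<close>
  on an interval of length \<open>1 / n\<close>. Pointwise limits of these bounded step functions
  are integrable, so measurability of \<Phi> need not be assumed.\<close>

lemma average_tendsto_integral:
  fixes G :: "nat \<Rightarrow> nat \<Rightarrow> real"
  assumes bound: "\<forall>\<^sub>F n in sequentially. \<forall>k<n. \<bar>G n k\<bar> \<le> B"
    and lim: "\<And>\<xi>. 0 < \<xi> \<Longrightarrow> \<xi> < 1 \<Longrightarrow> (\<lambda>n. G n (nat \<lfloor>real n * \<xi>\<rfloor>)) \<longlonglongrightarrow> \<Phi> \<xi>"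
  shows "set_integrable lborel {0..1} \<Phi>"
    and "(\<lambda>n. (\<Sum>k<n. G n k) / real n) \<longlonglongrightarrow> (LBINT \<xi>:{0..1}. \<Phi> \<xi>)"
proof -
  define s where "s n \<xi> = indicator {0<..<1} \<xi> * G n (nat \<lfloor>real n * \<xi>\<rfloor>)" for n \<xi>
  obtain N where N: "\<And>n k. n \<ge> N \<Longrightarrow> k < n \<Longrightarrow> \<bar>G n k\<bar> \<le> B"
    using bound unfolding eventually_sequentially by blast
  have s_meas [measurable]: "s n \<in> borel_measurable lborel" for n
    unfolding s_def by measurable
  have s_lim: "(\<lambda>n. s n \<xi>) \<longlonglongrightarrow> indicator {0<..<1} \<xi> * \<Phi> \<xi>" for \<xi>
    using lim[of \<xi>] by (cases "0 < \<xi> \<and> \<xi> < 1") (auto simp: s_def)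
  have \<Phi>_meas: "(\<lambda>\<xi>. indicator {0<..<1} \<xi> * \<Phi> \<xi>) \<in> borel_measurable lborel"
    by (rule borel_measurable_LIMSEQ_real[OF s_lim s_meas])
  have idx: "nat \<lfloor>real n * \<xi>\<rfloor> < n" if "0 < \<xi>" "\<xi> < 1" "0 < n" for n \<xi>
  proof -
    have "\<lfloor>real n * \<xi>\<rfloor> < int n"
      using that by (simp add: floor_less_iff)
    then show ?thesis using that by linarith
  qed
  \<comment> \<open>The shift skips the indices before the bound sets in, and \<open>Suc\<close>
    excludes \<open>n = 0\<close>, for which no index lies below \<open>n\<close>.\<close>
  have s_bound: "norm (s (n + Suc N) \<xi>) \<le> \<bar>B\<bar> * indicator {0<..<1} \<xi>" for n \<xi>
  proof (cases "0 < \<xi> \<and> \<xi> < 1")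
    case True
    then have "\<bar>G (n + Suc N) (nat \<lfloor>real (n + Suc N) * \<xi>\<rfloor>)\<bar> \<le> B"
      by (intro N idx) auto
    then show ?thesis using True by (simp add: s_def)
  qed (auto simp: s_def)
  have dom: "integrable lborel (\<lambda>\<xi>. \<bar>B\<bar> * indicator {0<..<1::real} \<xi>)"
    by (intro integrable_mult_right) simp
  have lim': "AE \<xi> in lborel. (\<lambda>n. s (n + Suc N) \<xi>) \<longlonglongrightarrow> indicator {0<..<1} \<xi> * \<Phi> \<xi>"
    by (intro AE_I2 LIMSEQ_ignore_initial_segment s_lim)
  have int: "integrable lborel (\<lambda>\<xi>. indicator {0<..<1} \<xi> * \<Phi> \<xi>)"
    by (rule integrable_dominated_convergence[OF \<Phi>_meas s_meas dom lim']) (intro AE_I2 s_bound)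
  have "(\<lambda>n. integral\<^sup>L lborel (s (n + Suc N))) \<longlonglongrightarrow> (LINT \<xi>|lborel. indicator {0<..<1} \<xi> * \<Phi> \<xi>)"
    by (rule integral_dominated_convergence[OF \<Phi>_meas s_meas dom lim']) (intro AE_I2 s_bound)
  then have conv: "(\<lambda>n. integral\<^sup>L lborel (s n)) \<longlonglongrightarrow> (LINT \<xi>|lborel. indicator {0<..<1} \<xi> * \<Phi> \<xi>)"
    by (rule LIMSEQ_offset)
  show "set_integrable lborel {0..1} \<Phi>"
    unfolding set_integrable_def
    by (rule integrable_discrete_difference[THEN iffD1, OF _ _ _ _ int, of "{0, 1}"]) (auto simp: indicator_def)
  have "(LINT \<xi>|lborel. indicator {0<..<1} \<xi> * \<Phi> \<xi>) = (LBINT \<xi>:{0..1}. \<Phi> \<xi>)"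
    unfolding set_lebesgue_integral_def
    by (rule integral_discrete_difference[of "{0, 1}"]) (auto simp: indicator_def)
  moreover have "integral\<^sup>L lborel (s n) = (\<Sum>k<n. G n k) / real n" if "n > 0" for n
  proof -
    let ?I = "\<lambda>k. {real k / real n..<(real k + 1) / real n}"
    have "integral\<^sup>L lborel (s n) = (LINT \<xi>|lborel. (\<Sum>k<n. G n k * indicator (?I k) \<xi>))"
    \<comment> \<open>At 0 the step function is cut off by the open interval, while the first
      half-open interval contains 0.\<close>
    proof (rule integral_discrete_difference[of "{0}"])
      fix \<xi> :: real assume "\<xi> \<notin> {0}"
      then consider "\<xi> < 0" | "0 < \<xi>" by fastforce
      then show "s n \<xi> = (\<Sum>k<n. G n k * indicator (?I k) \<xi>)"
      proof cases
        case 1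
        have "\<xi> \<notin> ?I k" for k
          using 1 \<open>n > 0\<close> order.strict_trans2[of \<xi> 0 "real k / real n"] by auto
        then show ?thesis using 1 by (simp add: s_def)
      next
        case 2
        have "\<xi> \<in> ?I k \<longleftrightarrow> k = nat \<lfloor>real n * \<xi>\<rfloor>" for k
        proof -
          have "\<xi> \<in> ?I k \<longleftrightarrow> real k \<le> real n * \<xi> \<and> real n * \<xi> < real k + 1"
            using \<open>n > 0\<close> by (simp add: field_simps)
          also have "\<dots> \<longleftrightarrow> \<lfloor>real n * \<xi>\<rfloor> = int k"
            by (simp add: floor_eq_iff)
          also have "\<dots> \<longleftrightarrow> k = nat \<lfloor>real n * \<xi>\<rfloor>"
            using 2 by (auto simp: nat_eq_iff)
          finally show ?thesis .
        qed
        then have "(\<Sum>k<n. G n k * indicator (?I k) \<xi>) =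
            (\<Sum>k<n. if k = nat \<lfloor>real n * \<xi>\<rfloor> then G n k else 0)"
          by (intro sum.cong) (auto simp: indicator_def)
        also have "\<dots> = s n \<xi>"
        proof (cases "\<xi> < 1")
          case True
          then show ?thesis using 2 idx[OF 2 True \<open>n > 0\<close>] by (simp add: s_def)
        next
          case False
          then have "int n \<le> \<lfloor>real n * \<xi>\<rfloor>"
            using \<open>n > 0\<close> by (simp add: le_floor_iff mult_le_cancel_left1)
          then have "\<not> nat \<lfloor>real n * \<xi>\<rfloor> < n" by linarith
          then show ?thesis using False by (simp add: s_def)
        qed
        finally show ?thesis ..
      qed
    qed auto
    also have "\<dots> = (\<Sum>k<n. G n k * (1 / real n))"
    proof (subst Bochner_Integration.integral_sum)
      fix k
      have le: "real k / real n \<le> (real k + 1) / real n"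
        using \<open>n > 0\<close> by (simp add: divide_right_mono)
      then show "integrable lborel (\<lambda>\<xi>. G n k * indicator (?I k) \<xi>)"
        by (intro integrable_mult_right) simp
    next
      have "measure lborel (?I k) = 1 / real n" for k
        using \<open>n > 0\<close> by (subst measure_lborel_Ico) (auto simp: divide_right_mono diff_divide_distrib[symmetric])
      then show "(\<Sum>k<n. LINT \<xi>|lborel. G n k * indicator (?I k) \<xi>) = (\<Sum>k<n. G n k * (1 / real n))"
        by simp
    qed
    finally show ?thesis by (simp add: sum_divide_distrib)
  qed
  ultimately have "(\<lambda>n. integral\<^sup>L lborel (s n)) \<longlonglongrightarrow> (LBINT \<xi>:{0..1}. \<Phi> \<xi>)"
    "\<forall>\<^sub>F n in sequentially. integral\<^sup>L lborel (s n) = (\<Sum>k<n. G n k) / real n"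
    using conv by (simp_all add: eventually_sequentiallyI[of 1])
  then show "(\<lambda>n. (\<Sum>k<n. G n k) / real n) \<longlonglongrightarrow> (LBINT \<xi>:{0..1}. \<Phi> \<xi>)"
    by (rule Lim_transform_eventually)
qed

text \<open>The expected sum of the squares \<open>(X n / n)\<^sup>2\<close> is dominated by the
  convergent series of \<open>V / n\<^sup>2\<close>. The sum is therefore almost surely finite and
  its terms tend to 0, whatever the joint law of the variables.\<close>

lemma AE_tendsto_0_of_second_moment:
  fixes X :: "nat \<Rightarrow> 'a \<Rightarrow> real"
  assumes meas: "\<And>n. n \<ge> N \<Longrightarrow> X n \<in> borel_measurable M"
    and bound: "\<And>n. n \<ge> N \<Longrightarrow> (\<integral>\<^sup>+\<omega>. ennreal ((X n \<omega>)\<^sup>2) \<partial>M) \<le> ennreal V"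
  shows "AE \<omega> in M. (\<lambda>n. X n \<omega> / real n) \<longlonglongrightarrow> 0"
proof -
  define N' where "N' = Suc N"
  define Y where "Y n \<omega> = (X (n + N') \<omega> / real (n + N'))\<^sup>2" for n \<omega>
  have [measurable]: "Y n \<in> borel_measurable M" for n
    using meas[of "n + N'"] unfolding Y_def N'_def by measurable
  \<comment> \<open>\<open>ennreal\<close> sends negative numbers to 0, so replacing
    \<open>V\<close> by its positive part keeps the bound and allows real arithmetic.\<close>
  define V' where "V' = max 0 V"
  have "V' \<ge> 0" and Vpos: "ennreal V = ennreal V'"
    by (simp_all add: V'_def max_def ennreal_neg)
  have Y_int: "(\<integral>\<^sup>+\<omega>. ennreal (Y n \<omega>) \<partial>M) \<le> ennreal (V' * (1 / real (n + N'))\<^sup>2)" for n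
  proof -
    have [measurable]: "X (n + N') \<in> borel_measurable M" using meas by (simp add: N'_def)
    have "(\<integral>\<^sup>+\<omega>. ennreal (Y n \<omega>) \<partial>M) =
        (\<integral>\<^sup>+\<omega>. ennreal ((1 / real (n + N'))\<^sup>2) * ennreal ((X (n + N') \<omega>)\<^sup>2) \<partial>M)"
      by (intro nn_integral_cong) (simp add: Y_def ennreal_mult[symmetric] power_divide)
    also have "\<dots> = ennreal ((1 / real (n + N'))\<^sup>2) * (\<integral>\<^sup>+\<omega>. ennreal ((X (n + N') \<omega>)\<^sup>2) \<partial>M)"
      by (intro nn_integral_cmult) measurable
    also have "\<dots> \<le> ennreal ((1 / real (n + N'))\<^sup>2) * ennreal V'"
      using bound[of "n + N'"] Vpos by (intro mult_left_mono) (auto simp: N'_def)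
    also have "\<dots> = ennreal (V' * (1 / real (n + N'))\<^sup>2)"
      by (subst ennreal_mult) (simp_all add: \<open>V' \<ge> 0\<close> mult.commute)
    finally show ?thesis .
  qed
  have summ: "summable (\<lambda>n. V' * (1 / real (n + N'))\<^sup>2)"
  proof -
    have "summable (\<lambda>n. 1 / real n ^ 2)"
      using inverse_power_summable[of 2, where 'a = real] by (simp add: inverse_eq_divide)
    then have "summable (\<lambda>n. 1 / real (n + N') ^ 2)"
      by (subst summable_iff_shift)
    then show ?thesis by (intro summable_mult) (simp add: power_divide)
  qed
  have "(\<integral>\<^sup>+\<omega>. (\<Sum>n. ennreal (Y n \<omega>)) \<partial>M) = (\<Sum>n. \<integral>\<^sup>+\<omega>. ennreal (Y n \<omega>) \<partial>M)"
    by (rule nn_integral_suminf) measurable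
  also have "\<dots> \<le> (\<Sum>n. ennreal (V' * (1 / real (n + N'))\<^sup>2))"
    by (intro suminf_le Y_int) auto
  also have "\<dots> < \<infinity>"
    using summ \<open>V' \<ge> 0\<close> by (subst suminf_ennreal2) auto
  finally have "(\<integral>\<^sup>+\<omega>. (\<Sum>n. ennreal (Y n \<omega>)) \<partial>M) \<noteq> \<infinity>" by simp
  then have "AE \<omega> in M. (\<Sum>n. ennreal (Y n \<omega>)) \<noteq> \<infinity>"
    by (intro nn_integral_PInf_AE) measurable
  then show ?thesis
  proof eventually_elim
    case (elim \<omega>)
    then have "summable (\<lambda>n. Y n \<omega>)"
      by (intro summable_suminf_not_top) (auto simp: Y_def)
    then have "(\<lambda>n. sqrt (Y n \<omega>)) \<longlonglongrightarrow> sqrt 0"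
      by (intro tendsto_real_sqrt summable_LIMSEQ_zero)
    then have "(\<lambda>n. \<bar>X (n + N') \<omega> / real (n + N')\<bar>) \<longlonglongrightarrow> 0"
      by (simp add: Y_def)
    then have "(\<lambda>n. X (n + N') \<omega> / real (n + N')) \<longlonglongrightarrow> 0"
      by (rule tendsto_rabs_zero_cancel)
    then show ?case by (rule LIMSEQ_offset)
  qed
qed

theorem theorem2p1:
  fixes M :: "'\<omega> measure"
    and \<nu> w :: "nat \<Rightarrow> int \<Rightarrow> real"
    and x :: "nat \<Rightarrow> nat \<Rightarrow> '\<omega> \<Rightarrow> real"
    and P :: "nat \<Rightarrow> nat \<Rightarrow> real poly"
    and \<alpha> \<beta> :: "nat \<Rightarrow> nat \<Rightarrow> real"
    and a b :: "real \<Rightarrow> real"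
    and p :: "real poly"
  assumes "prob_space M"
    and "\<And>n. 1 \<le> n \<Longrightarrow> admissible n (\<nu> n) (w n)"
    and "\<And>n. 1 \<le> n \<Longrightarrow> orthogonal_polynomial_ensemble M (\<nu> n) (w n) n (x n)"
    and "\<And>n. 1 \<le> n \<Longrightarrow> orthonormal_polys (\<nu> n) (w n) (P n)"
    and "\<And>n. 1 \<le> n \<Longrightarrow> recurrence_coeffs (\<nu> n) (w n) (P n) (\<alpha> n) (\<beta> n)"
    and "continuous_on {0..1} a"
    and "continuous_on {0..1} b"
    and "\<And>\<xi>. \<xi> \<in> {0..1} \<Longrightarrow> 0 \<le> a \<xi>"
    and "\<exists>\<xi> \<in> {0..1}. a \<xi> \<noteq> 0"
    and "\<And>\<xi> j. \<xi> \<in> {0..1} \<Longrightarrow> (\<lambda>n. real (j n) / real n) \<longlonglongrightarrow> \<xi> \<Longrightarrow>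
           \<forall>\<^sub>F n in sequentially. recurrence_index (w n) (j n)"
    and "\<And>\<xi> j. \<xi> \<in> {0..1} \<Longrightarrow> (\<lambda>n. real (j n) / real n) \<longlonglongrightarrow> \<xi> \<Longrightarrow>
           (\<lambda>n. \<alpha> n (j n)) \<longlonglongrightarrow> a \<xi>"
    and "\<And>\<xi> j. \<xi> \<in> {0..1} \<Longrightarrow> (\<lambda>n. real (j n) / real n) \<longlonglongrightarrow> \<xi> \<Longrightarrow>
           (\<lambda>n. \<beta> n (j n)) \<longlonglongrightarrow> b \<xi>"
  shows "AE \<omega> in M.
    (\<lambda>n. 1 / real n * linear_statistic n (x n) (poly p \<circ> \<mu>_of (\<nu> n) n) \<omega>) \<longlonglongrightarrow>
      1 / pi * (LBINT \<xi>:{0..1}.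
          (if a \<xi> = 0 then 0
           else (LBINT t:{b \<xi> - 2 * a \<xi>..b \<xi> + 2 * a \<xi>}.
                   poly p t / sqrt (4 * (a \<xi>)\<^sup>2 - (t - b \<xi>)\<^sup>2)))) +
      (LBINT \<xi>:{\<xi> \<in> {0..1}. a \<xi> = 0}. poly p (b \<xi>))"
proof -
  define D where "D = degree p"
  define F where "F n = poly_jacobi p (\<alpha> n) (\<beta> n)" for n
  define X where "X n \<omega> = linear_statistic n (x n) (poly p \<circ> \<mu>_of (\<nu> n) n) \<omega>" for n \<omega>
  define m where "m n = (\<Sum>k<n. F n k k)" for n
  define \<Phi> where "\<Phi> \<xi> = arcsine_mean p (a \<xi>) (b \<xi>)" for \<xi>
  obtain C1 C2 where
    C1: "\<forall>\<^sub>F n in sequentially. \<forall>j\<le>n + D. \<bar>\<alpha> n j\<bar> \<le> C1" and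
    C2: "\<forall>\<^sub>F n in sequentially. \<forall>j\<le>n + D. \<bar>\<beta> n j\<bar> \<le> C2"
    using bounded_of_ray_limits[of \<alpha> a D] bounded_of_ray_limits[of \<beta> b D] assms(11,12) by blast
  define C where "C = max C1 C2"
  define B where "B = (\<Sum>d\<le>degree p. \<bar>Polynomial.coeff p d\<bar> * (3 * C) ^ d)"
  \<comment> \<open>The indices from \<open>n\<close> to \<open>n + D\<close>, which the variance
    involves, are reached through the endpoint \<xi> = 1.\<close>
  have "(\<lambda>n. real (n + D) / real n) \<longlonglongrightarrow> 1"
    by real_asymp
  then have idx: "\<forall>\<^sub>F n in sequentially. recurrence_index (w n) (n + D)"
    using assms(10)[of 1 "\<lambda>n. n + D"] by simp
  have bound: "\<forall>\<^sub>F n in sequentially. \<forall>k<n. \<forall>l. \<bar>F n k l\<bar> \<le> B"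
    using C1 C2
  proof eventually_elim
    case (elim n)
    show ?case
    proof (intro allI impI)
      fix k l assume "k < n"
      then show "\<bar>F n k l\<bar> \<le> B"
        using elim unfolding F_def B_def
        by (intro poly_jacobi_bound) (auto simp: C_def D_def intro: max.coboundedI1 max.coboundedI2)
    qed
  qed
  have diag: "(\<lambda>n. F n (nat \<lfloor>real n * \<xi>\<rfloor>) (nat \<lfloor>real n * \<xi>\<rfloor>)) \<longlonglongrightarrow> \<Phi> \<xi>" if \<xi>: "0 < \<xi>" "\<xi> < 1" for \<xi>
  proof -
    define k where "k n = nat \<lfloor>real n * \<xi>\<rfloor>" for n
    have "(\<lambda>n. real (k n) / real n) \<longlonglongrightarrow> \<xi>" "filterlim k at_top sequentially"
      unfolding k_def using \<xi> by real_asymp+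
    \<comment> \<open>The diagonal is the offset 0. Positivity of \<xi> has just been used to send
      the row index to infinity, away from the boundary of the matrix.\<close>
    then have "(\<lambda>n. jacobi_power (\<alpha> n) (\<beta> n) d (k n) (nat (int (k n) + 0)))
        \<longlonglongrightarrow> arcsine_moment (a \<xi>) (b \<xi>) d 0" for d
      using \<xi> assms(11,12) by (intro jacobi_power_limit) auto
    then show ?thesis
      unfolding F_def poly_jacobi_def \<Phi>_def arcsine_mean_eq_moments k_def[symmetric]
      by (intro tendsto_sum tendsto_mult_left) simp
  qed
  have "\<forall>\<^sub>F n in sequentially. \<forall>k<n. \<bar>F n k k\<bar> \<le> B"
    using bound by eventually_elim blast
  note avg = average_tendsto_integral[where G = "\<lambda>n k. F n k k", OF this diag]
  have "\<forall>\<^sub>F n in sequentially. n \<ge> 1 \<and> recurrence_index (w n) (n + D) \<and> (\<forall>k<n. \<forall>l. \<bar>F n k l\<bar> \<le> B)"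
    using idx bound eventually_ge_at_top[of 1] by eventually_elim blast
  then obtain N where
    "\<forall>n\<ge>N. n \<ge> 1 \<and> recurrence_index (w n) (n + D) \<and> (\<forall>k<n. \<forall>l. \<bar>F n k l\<bar> \<le> B)"
    unfolding eventually_sequentially by blast
  then have N: "n \<ge> 1" "recurrence_index (w n) (n + D)" "\<And>k l. k < n \<Longrightarrow> \<bar>F n k l\<bar> \<le> B"
    if "n \<ge> N" for n
    using that by auto
  have "AE \<omega> in M. (\<lambda>n. (X n \<omega> - m n) / real n) \<longlonglongrightarrow> 0"
  proof (rule AE_tendsto_0_of_second_moment)
    fix n assume n: "n \<ge> N"
    show "(\<integral>\<^sup>+\<omega>. ennreal ((X n \<omega> - m n)\<^sup>2) \<partial>M) \<le> ennreal (real (D * (D + 1)) * B\<^sup>2)"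
    proof -
      have "(\<integral>\<^sup>+\<omega>. ennreal ((X n \<omega> - m n)\<^sup>2) \<partial>M) = ennreal (\<Sum>k<n. \<Sum>l=n..n + degree p. (F n k l)\<^sup>2)"
        unfolding X_def m_def F_def
        using N(2)[OF n] assms(1) assms(3-5)[OF N(1)[OF n]] N(1)[OF n]
        by (intro linear_statistic_variance[where P = "P n" and w = "w n"]) (simp_all add: D_def)
      also have "\<dots> \<le> ennreal (real (D * (D + 1)) * B\<^sup>2)"
        unfolding D_def[symmetric]
        by (intro ennreal_leI corner_sum_bound N(3)[OF n]) (auto simp: F_def D_def poly_jacobi_eq_0)
      finally show ?thesis .
    qed
    have "x n j \<in> borel_measurable M" "x n j \<in> M \<rightarrow>\<^sub>M borel" if "j \<in> {1..n}" for j
      using assms(3)[OF N(1)[OF n]] that by (simp_all add: orthogonal_polynomial_ensemble_def)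
    then have "(\<lambda>\<omega>. (poly p \<circ> \<mu>_of (\<nu> n) n) (x n j \<omega>)) \<in> borel_measurable M" if "j \<in> {1..n}" for j
      using that unfolding \<mu>_of_def lattice_int_def o_def by measurable
    then show "(\<lambda>\<omega>. X n \<omega> - m n) \<in> borel_measurable M"
      unfolding X_def linear_statistic_def by (intro borel_measurable_diff borel_measurable_sum) auto
  qed
  then show ?thesis
  proof eventually_elim
    case (elim \<omega>)
    have "(\<lambda>n. (X n \<omega> - m n) / real n + m n / real n) \<longlonglongrightarrow> 0 + (LBINT \<xi>:{0..1}. \<Phi> \<xi>)"
      unfolding m_def by (intro tendsto_add elim[unfolded m_def] avg(2))
    then have "(\<lambda>n. 1 / real n * X n \<omega>) \<longlonglongrightarrow> (LBINT \<xi>:{0..1}. \<Phi> \<xi>)"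
      by (simp add: diff_divide_distrib)
    then show ?case
      unfolding X_def \<Phi>_def
      by (subst arcsine_mean_integral_split[OF assms(6,8) avg(1)[unfolded \<Phi>_def]])
  qed
qed

end
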